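(* $\mathsf{wList}\equiv_{\mathrm W}\mathsf{List}\equiv_{\mathrm W}\mathsf{UC}_{\mathbb{N}^\mathbb{N}}$.
   Context: A represented space is a set $X$ with a partial surjection $\delta_X:\subseteq\mathbb{N}^\mathbb{N}\to X$ (names). A partial $F$ realizes a partial multivalued $f:\subseteq X\rightrightarrows Y$ if for every $x\in\operatorname{dom}(f)$ and name $p$ of $x$, $F(p)$ names an element of $f(x)$. $f\le_{\mathrm W}g$ if there are computable partial $H,K:\subseteq\mathbb{N}^\mathbb{N}\to\mathbb{N}^\mathbb{N}$ such that for every realizer $G$ of $g$, $p\mapsto K(\langle p,G(H(p))\rangle)$ realizes $f$; $\equiv_{\mathrm W}$ is mutual reducibility. $\mathcal{A}(\mathbb{N}^\mathbb{N})$ is the space of closed subsets of $\mathbb{N}^\mathbb{N}$, a name of $A$ being (the characteristic function of) a tree $T\subseteq\mathbb{N}^{<\mathbb{N}}$ whose set of infinite paths is $A$. $\mathsf{UC}_{\mathbb{N}^\mathbb{N}}:\subseteq\mathcal{A}(\mathbb{N}^\mathbb{N})\to\mathbb{N}^\mathbb{N}$ maps each singleton $\{x\}$ to $x$. Angle brackets denote standard pairings/tuplings into $\mathbb{N}^\mathbb{N}$, and $bp$ denotes the sequence starting with $b\in\mathbb{N}$ followed by $p$. $\mathsf{wList}:\subseteq\mathcal{A}(\mathbb{N}^\mathbb{N})\rightrightarrows(\mathbb{N}^\mathbb{N})^\omega$ is defined on countable closed $A$ and maps $A$ to all $\langle b_0p_0,b_1p_1,\dots\rangle$ with $A=\{p_i: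 b_i=1\}$. $\mathsf{List}:\subseteq\mathcal{A}(\mathbb{N}^\mathbb{N})\rightrightarrows\mathbb{N}^\mathbb{N}$ is defined on countable closed $A$ and maps $A$ to all $n\langle p_0,p_1,\dots\rangle$ such that either $n=0$, $p_i\ne p_j$ for $i\ne j$ and $A=\{p_i:i\in\mathbb{N}\}$; or $n>0$, $|A|=n-1$ and $A=\{p_i:i<n-1\}$. *)

theory Defs
  imports "HOL-Analysis.Function_Topology" "HOL-Library.Nat_Bijection"
begin

type_synonym baire = "nat \<Rightarrow> nat"


section \<open>Computable partial functions on Baire space\<close>

text \<open>
  Type-two computability is rendered by oracle computation: from a name given as an oracle,
  a program of the usual recursion schemes (with \<^term>\<open>p\<close> as an additional basic function)
  computes the output sequence value by value.
\<close>

datatype prog =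
    Zero
  | Succ
  | Proj nat
  | Oracle
  | Comp prog "prog list"
  | PrimRec prog prog
  | Mu prog

inductive eval :: "baire \<Rightarrow> prog \<Rightarrow> nat list \<Rightarrow> nat \<Rightarrow> bool" for p :: baire where
  eval_Zero: "eval p Zero xs 0"
| eval_Succ: "eval p Succ (x # xs) (Suc x)"
| eval_Proj: "i < length xs \<Longrightarrow> eval p (Proj i) xs (xs ! i)"
| eval_Oracle: "eval p Oracle (x # xs) (p x)"
| eval_Comp: "list_all2 (\<lambda>g y. eval p g xs y) gs ys \<Longrightarrow> eval p f ys z \<Longrightarrow> eval p (Comp f gs) xs z"
| eval_PrimRec_0: "eval p f xs y \<Longrightarrow> eval p (PrimRec f g) (0 # xs) y"
| eval_PrimRec_Suc: "eval p (PrimRec f g) (n # xs) r \<Longrightarrow> eval p g (n # r # xs) y \<Longrightarrow>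
    eval p (PrimRec f g) (Suc n # xs) y"
| eval_Mu: "eval p f (n # xs) 0 \<Longrightarrow> (\<And>m. m < n \<Longrightarrow> \<exists>k. eval p f (m # xs) (Suc k)) \<Longrightarrow>
    eval p (Mu f) xs n"

inductive_cases eval_ZeroE: "eval p Zero xs z"
inductive_cases eval_SuccE: "eval p Succ xs z"
inductive_cases eval_ProjE: "eval p (Proj i) xs z"
inductive_cases eval_OracleE: "eval p Oracle xs z"
inductive_cases eval_CompE: "eval p (Comp f gs) xs z"
inductive_cases eval_PrimRec_0E: "eval p (PrimRec f g) (0 # xs) z"
inductive_cases eval_PrimRec_SucE: "eval p (PrimRec f g) (Suc n # xs) z"
inductive_cases eval_MuE: "eval p (Mu f) xs z"

lemma eval_functional: "eval p f xs y \<Longrightarrow> eval p f xs z \<Longrightarrow> y = z"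
proof (induction arbitrary: z rule: eval.induct)
  case (eval_Comp xs gs ys f y)
  from eval_Comp.prems obtain zs where zs: "list_all2 (\<lambda>g y. eval p g xs y) gs zs" "eval p f zs z"
    by (rule eval_CompE)
  have "ys = zs"
  proof (rule nth_equalityI)
    show "length ys = length zs"
      using list_all2_lengthD[OF eval_Comp.IH(1)] list_all2_lengthD[OF zs(1)] by simp
    fix i assume "i < length ys"
    then have "i < length gs" using list_all2_lengthD[OF eval_Comp.IH(1)] by simp
    from list_all2_nthD[OF eval_Comp.IH(1) this] list_all2_nthD[OF zs(1) this]
    show "ys ! i = zs ! i" by blast
  qed
  with zs(2) show ?case by (intro eval_Comp.IH(2)) simp
next
  case (eval_PrimRec_Suc f g n xs r y)
  from eval_PrimRec_Suc.prems obtain s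
    where "eval p (PrimRec f g) (n # xs) s" "eval p g (n # s # xs) z"
    by (rule eval_PrimRec_SucE)
  from eval_PrimRec_Suc.IH(1)[OF this(1)] this(2) show ?case
    by (intro eval_PrimRec_Suc.IH(2)) simp
next
  case (eval_Mu f n xs)
  from eval_Mu.prems have "eval p f (z # xs) 0 \<and> (\<forall>m<z. \<exists>k. eval p f (m # xs) (Suc k))"
    by (rule eval_MuE) (intro conjI allI impI)
  then have z: "eval p f (z # xs) 0" "\<forall>m<z. \<exists>k. eval p f (m # xs) (Suc k)"
    by (rule conjunct1, rule conjunct2)
  have "\<not> n < z"
  proof
    assume "n < z"
    with z(2) obtain k where "eval p f (n # xs) (Suc k)" by blast
    from eval_Mu.IH(1)[OF this] show False by simp
  qed
  moreover have "\<not> z < n"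
  proof
    assume "z < n"
    from eval_Mu.IH(2)[OF this] z(1) show False by blast
  qed
  ultimately show ?case by linarith
next
  case (eval_PrimRec_0 f xs y g)
  from eval_PrimRec_0.prems have "eval p f xs z" by (rule eval_PrimRec_0E)
  then show ?case by (rule eval_PrimRec_0.IH)
qed (auto elim: eval_ZeroE eval_SuccE eval_ProjE eval_OracleE)

text \<open>As usual, a computable partial function may be a restriction of what its program computes.\<close>

definition computable :: "(baire \<rightharpoonup> baire) \<Rightarrow> bool" where
  "computable F \<longleftrightarrow> (\<exists>e. \<forall>p q. F p = Some q \<longrightarrow> (\<forall>n. eval p e [n] (q n)))"


section \<open>Represented spaces, problems and Weihrauch reducibility\<close>

text \<open>
  A represented space is given by its representation \<^term>\<open>\<delta>\<close>; the underlying set is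
  \<^term>\<open>ran \<delta>\<close>.  A problem is a partial multivalued function between represented spaces; its
  domain consists of the points with at least one admissible value.
\<close>

type_synonym 'a representation = "baire \<rightharpoonup> 'a"

record ('a, 'b) problem =
  source :: "'a representation"
  target :: "'b representation"
  vals :: "'a \<Rightarrow> 'b set"

definition dom_problem :: "('a, 'b) problem \<Rightarrow> 'a set" where
  "dom_problem f = {x \<in> ran (source f). vals f x \<noteq> {}}"

definition realizes :: "(baire \<rightharpoonup> baire) \<Rightarrow> ('a, 'b) problem \<Rightarrow> bool" where
  "realizes F f \<longleftrightarrow>
    (\<forall>x \<in> dom_problem f. \<forall>p. source f p = Some x \<longrightarrow>
      (\<exists>q y. F p = Some q \<and> target f q = Some y \<and> y \<in> vals f x))"

definition pair :: "baire \<Rightarrow> baire \<Rightarrow> baire" where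
  "pair p q = (\<lambda>n. if even n then p (n div 2) else q (n div 2))"

definition tuple :: "(nat \<Rightarrow> baire) \<Rightarrow> baire" where
  "tuple s = (\<lambda>k. case prod_decode k of (i, n) \<Rightarrow> s i n)"

definition weihrauch_le :: "('a, 'b) problem \<Rightarrow> ('c, 'd) problem \<Rightarrow> bool" (infix "\<le>\<^sub>W" 50) where
  "f \<le>\<^sub>W g \<longleftrightarrow>
    (\<exists>H K. computable H \<and> computable K \<and>
      (\<forall>G. realizes G g \<longrightarrow>
        realizes (\<lambda>p. Option.bind (H p) (\<lambda>q. Option.bind (G q) (\<lambda>r. K (pair p r)))) f))"

definition weihrauch_equiv :: "('a, 'b) problem \<Rightarrow> ('c, 'd) problem \<Rightarrow> bool" (infix "\<equiv>\<^sub>W" 50) where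
  "f \<equiv>\<^sub>W g \<longleftrightarrow> f \<le>\<^sub>W g \<and> g \<le>\<^sub>W f"


section \<open>The represented spaces involved\<close>

definition baire_rep :: "baire representation" where
  "baire_rep p = Some p"

definition baire_seq_rep :: "(nat \<Rightarrow> baire) representation" where
  "baire_seq_rep p = Some (\<lambda>i n. p (prod_encode (i, n)))"

lemma baire_seq_rep_eq_Some_iff: "baire_seq_rep p = Some s \<longleftrightarrow> p = tuple s"
proof
  assume "baire_seq_rep p = Some s"
  then have s: "s = (\<lambda>i n. p (prod_encode (i, n)))" by (simp add: baire_seq_rep_def)
  show "p = tuple s"
  proof
    fix k
    show "p k = tuple s k"
      unfolding tuple_def s by (cases "prod_decode k") (metis case_prod_conv prod_decode_inverse)
  qed
qed (simp add: baire_seq_rep_def tuple_def)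

definition is_tree :: "nat list set \<Rightarrow> bool" where
  "is_tree T \<longleftrightarrow> (\<forall>u v. u @ v \<in> T \<longrightarrow> u \<in> T)"

definition paths :: "nat list set \<Rightarrow> baire set" where
  "paths T = {x. \<forall>n. map x [0..<n] \<in> T}"

text \<open>
  Finite sequences are coded by \<^term>\<open>list_encode\<close>, which is a bijection.  The empty tree is
  allowed.
\<close>

definition closed_rep :: "baire set representation" where
  "closed_rep p =
    (let T = {u. p (list_encode u) = 1} in
      if is_tree T \<and> range p \<subseteq> {0, 1} then Some (paths T) else None)"

lemma closed_rep_eq_Some_iff:
  "closed_rep p = Some A \<longleftrightarrow>
    (\<exists>T. is_tree T \<and> p = (\<lambda>k. if list_decode k \<in> T then 1 else 0) \<and> A = paths T)"
proof
  assume p: "closed_rep p = Some A"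
  define T where "T = {u. p (list_encode u) = 1}"
  have T: "is_tree T" "range p \<subseteq> {0, 1}" "A = paths T"
    using p by (auto simp: closed_rep_def T_def Let_def split: if_splits)
  have "p k = (if list_decode k \<in> T then 1 else 0)" for k
    using T(2) by (auto simp: T_def)
  with T show "\<exists>T. is_tree T \<and> p = (\<lambda>k. if list_decode k \<in> T then 1 else 0) \<and> A = paths T"
    by blast
next
  assume "\<exists>T. is_tree T \<and> p = (\<lambda>k. if list_decode k \<in> T then 1 else 0) \<and> A = paths T"
  then obtain T where T: "is_tree T" "p = (\<lambda>k. if list_decode k \<in> T then 1 else 0)" "A = paths T"
    by blast
  have "{u. p (list_encode u) = 1} = T" "range p \<subseteq> {0, 1}" by (auto simp: T(2))
  with T(1,3) show "closed_rep p = Some A" by (simp add: closed_rep_def)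
qed

lemma tendsto_baire_iff:
  fixes y :: "nat \<Rightarrow> baire"
  shows "y \<longlonglongrightarrow> x \<longleftrightarrow> (\<forall>n. \<forall>\<^sub>F k in sequentially. \<forall>i<n. y k i = x i)"
proof -
  have "y \<longlonglongrightarrow> x \<longleftrightarrow> limitin (product_topology (\<lambda>_. euclidean) UNIV) y x sequentially"
    by (simp add: euclidean_product_topology)
  also have "\<dots> \<longleftrightarrow> (\<forall>i. \<forall>\<^sub>F k in sequentially. y k i = x i)"
    by (simp add: limitin_componentwise tendsto_discrete)
  also have "\<dots> \<longleftrightarrow> (\<forall>n. \<forall>\<^sub>F k in sequentially. \<forall>i\<in>{..<n}. y k i = x i)"
  proof safe
    fix n assume "\<forall>i. \<forall>\<^sub>F k in sequentially. y k i = x i"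
    then show "\<forall>\<^sub>F k in sequentially. \<forall>i\<in>{..<n}. y k i = x i"
      by (intro eventually_ball_finite) auto
  next
    fix i assume "\<forall>n. \<forall>\<^sub>F k in sequentially. \<forall>i\<in>{..<n}. y k i = x i"
    then have "\<forall>\<^sub>F k in sequentially. \<forall>j\<in>{..<Suc i}. y k j = x j" by blast
    then show "\<forall>\<^sub>F k in sequentially. y k i = x i" by (rule eventually_mono) simp
  qed
  finally show ?thesis by (simp add: Ball_def)
qed

lemma closed_paths: "closed (paths T)"
  unfolding closed_sequential_limits
proof safe
  fix y x assume y: "\<forall>k. y k \<in> paths T" "y \<longlonglongrightarrow> x"
  show "x \<in> paths T"
    unfolding paths_def
  proof safe
    fix n
    obtain k where "\<forall>i<n. y k i = x i"
      using y(2) unfolding tendsto_baire_iff eventually_sequentially by blast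
    then have "map (y k) [0..<n] = map x [0..<n]" by simp
    moreover have "map (y k) [0..<n] \<in> T" using y(1) by (simp add: paths_def)
    ultimately show "map x [0..<n] \<in> T" by (rule subst)
  qed
qed

lemma ran_closed_rep: "ran closed_rep = {A. closed A}"
proof safe
  fix A assume "A \<in> ran closed_rep"
  then show "closed A" by (auto simp: ran_def closed_rep_eq_Some_iff closed_paths)
next
  fix A :: "baire set" assume A: "closed A"
  define T where "T = {u. \<exists>x\<in>A. u = map x [0..<length u]}"
  have tree: "is_tree T"
    unfolding is_tree_def
  proof safe
    fix u v assume "u @ v \<in> T"
    then obtain x where x: "x \<in> A" "u @ v = map x [0..<length (u @ v)]" by (auto simp: T_def)
    have "u = take (length u) (u @ v)" by simp
    also have "\<dots> = map x [0..<length u]" by (subst x(2)) (simp add: take_map)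
    finally show "u \<in> T" using x(1) by (auto simp: T_def)
  qed
  have "paths T = A"
  proof
    show "A \<subseteq> paths T" by (auto simp: paths_def T_def)
    show "paths T \<subseteq> A"
    proof
      fix x assume "x \<in> paths T"
      then have "\<forall>n. \<exists>z\<in>A. map x [0..<n] = map z [0..<n]" by (auto simp: paths_def T_def)
      then obtain z where z: "\<And>n. z n \<in> A" "\<And>n. map x [0..<n] = map (z n) [0..<n]" by metis
      have "\<forall>i<n. z k i = x i" if "n \<le> k" for n k
      proof (intro allI impI)
        fix i assume "i < n"
        with that have "i < k" by simp
        then have "map x [0..<k] ! i = x i" "map (z k) [0..<k] ! i = z k i" by simp_all
        then show "z k i = x i" using z(2)[of k] by simp
      qed
      then have "z \<longlonglongrightarrow> x" unfolding tendsto_baire_iff eventually_sequentially by blast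
      with A z(1) show "x \<in> A" unfolding closed_sequential_limits by blast
    qed
  qed
  with tree have "closed_rep (\<lambda>k. if list_decode k \<in> T then 1 else 0) = Some A"
    by (auto simp: closed_rep_eq_Some_iff)
  then show "A \<in> ran closed_rep" by (auto simp: ran_def)
qed


section \<open>The three problems\<close>

definition UC_Baire :: "(baire set, baire) problem" where
  "UC_Baire = \<lparr>source = closed_rep, target = baire_rep, vals = (\<lambda>A. {x. A = {x}})\<rparr>"

abbreviation cons :: "nat \<Rightarrow> baire \<Rightarrow> baire" (infixr "\<frown>" 65) where
  "b \<frown> p \<equiv> case_nat b p"

text \<open>
  In \<^term>\<open>wList\<close> the markers are arbitrary natural numbers and only those equal to 1 count;
  repetitions are allowed.
\<close>

definition wList :: "(baire set, nat \<Rightarrow> baire) problem" where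
  "wList = \<lparr>source = closed_rep, target = baire_seq_rep,
    vals = (\<lambda>A. {s. closed A \<and> countable A \<and>
      (\<exists>b p. s = (\<lambda>i. b i \<frown> p i) \<and> A = {p i |i. b i = 1})})\<rparr>"

definition List :: "(baire set, baire) problem" where
  "List = \<lparr>source = closed_rep, target = baire_rep,
    vals = (\<lambda>A. {q. closed A \<and> countable A \<and>
      (\<exists>n p. q = n \<frown> tuple p \<and>
        (n = 0 \<and> (\<forall>i j. i \<noteq> j \<longrightarrow> p i \<noteq> p j) \<and> A = {p i |i. True} \<or>
         n > 0 \<and> finite A \<and> card A = n - 1 \<and> A = {p i |i. i < n - 1}))})\<rparr>"

lemma dom_UC_Baire: "dom_problem UC_Baire = {{x} |x. True}"
proof -
  have "closed {x}" for x :: baire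
  proof -
    have "paths {u. u = map x [0..<length u]} = {x}"
    proof safe
      fix y assume y: "y \<in> paths {u. u = map x [0..<length u]}"
      have "y i = x i" for i
      proof -
        have "map y [0..<Suc i] = map x [0..<Suc i]" using y by (simp add: paths_def del: upt_Suc)
        then show ?thesis by simp
      qed
      then show "y = x" by blast
    qed (simp add: paths_def)
    then show ?thesis by (metis closed_paths)
  qed
  then show ?thesis by (auto simp: dom_problem_def UC_Baire_def ran_closed_rep)
qed

lemma dom_wList: "dom_problem wList = {A. closed A \<and> countable A}"
proof -
  have "vals wList A \<noteq> {}" if A: "closed A" "countable A" for A
  proof -
    define b :: "nat \<Rightarrow> nat" where "b = (\<lambda>_. if A = {} then 0 else 1)"
    define s where "s = (\<lambda>i. b i \<frown> from_nat_into A i)"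
    have "A = {from_nat_into A i |i. b i = 1}"
    proof (cases "A = {}")
      case True
      then show ?thesis by (simp add: b_def)
    next
      case False
      then show ?thesis
        using range_from_nat_into[OF False A(2)] by (simp add: b_def full_SetCompr_eq)
    qed
    with A s_def have "s \<in> vals wList A"
      unfolding wList_def problem.simps mem_Collect_eq by (intro conjI exI) assumption+
    then show ?thesis by blast
  qed
  moreover have "closed A \<and> countable A" if "vals wList A \<noteq> {}" for A
    using that unfolding wList_def problem.simps by blast
  ultimately have "vals wList A \<noteq> {} \<longleftrightarrow> closed A \<and> countable A" for A by iprover
  moreover have "source wList = closed_rep" by (simp add: wList_def)
  ultimately show ?thesis by (simp add: dom_problem_def ran_closed_rep)
qed

lemma dom_List: "dom_problem List = {A. closed A \<and> countable A}"
proof -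
  have "vals List A \<noteq> {}" if A: "closed A" "countable A" for A
  proof -
    have "\<exists>n p. n = 0 \<and> (\<forall>i j. i \<noteq> j \<longrightarrow> p i \<noteq> p j) \<and> A = {p i |i. True} \<or>
      n > 0 \<and> finite A \<and> card A = n - 1 \<and> A = {p i |i. i < n - 1}"
    proof (cases "finite A")
      case True
      then obtain p where p: "bij_betw p {0..<card A} A" using ex_bij_betw_nat_finite by blast
      define n where "n = Suc (card A)"
      have "A = p ` {0..<card A}" using p by (simp add: bij_betw_def)
      also have "\<dots> = {p i |i. i < n - 1}" by (auto simp: n_def)
      finally have "A = {p i |i. i < n - 1}" .
      moreover have "n > 0" "card A = n - 1" by (simp_all add: n_def)
      ultimately show ?thesis using True by (intro exI disjI2 conjI)
    next
      case False
      define p where "p = from_nat_into A"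
      define n :: nat where "n = 0"
      have "bij_betw p UNIV A"
        unfolding p_def using bij_betw_from_nat_into[OF A(2) False] .
      then have "inj p" "A = {p i |i. True}" by (auto simp: bij_betw_def)
      moreover from \<open>inj p\<close> have "\<forall>i j. i \<noteq> j \<longrightarrow> p i \<noteq> p j" by (simp add: inj_eq)
      ultimately show ?thesis using n_def by (intro exI disjI1 conjI)
    qed
    then obtain n p where np:
      "n = 0 \<and> (\<forall>i j. i \<noteq> j \<longrightarrow> p i \<noteq> p j) \<and> A = {p i |i. True} \<or>
       n > 0 \<and> finite A \<and> card A = n - 1 \<and> A = {p i |i. i < n - 1}" by iprover
    define q where "q = n \<frown> tuple p"
    from A np q_def have "q \<in> vals List A"
      unfolding List_def problem.simps mem_Collect_eq by (intro conjI exI) assumption+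
    then show ?thesis by blast
  qed
  moreover have "closed A \<and> countable A" if "vals List A \<noteq> {}" for A
    using that unfolding List_def problem.simps by blast
  ultimately have "vals List A \<noteq> {} \<longleftrightarrow> closed A \<and> countable A" for A by iprover
  moreover have "source List = closed_rep" by (simp add: List_def)
  ultimately show ?thesis by (simp add: dom_problem_def ran_closed_rep)
qed

end

theory Submission
  imports Defs "HOL-Library.Sublist"
begin

text \<open>
  The substantial reduction is from \<^term>\<open>List\<close> to \<^term>\<open>UC_Baire\<close>. Call a node of the tree thin
  if among any two incompatible extensions of it in the tree one is already thin; if there are only
  countably many paths, every node is inductively thin, since otherwise a Cantor scheme could be
  built. The comparison of the inductive stages at which nodes become thin is the unique
  solution of an arithmetical recursion, hence, after adjoining the least witnesses of its
  existential quantifiers, the unique point of an effectively closed set. The extensions of a node of the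
  same stage as the node itself form a chain, and every path is the limit of such a chain, because
  stages cannot decrease for ever along it. So the paths are enumerated arithmetically in the stage
  comparison, and arithmetical post-processing is absorbed by unique choice in the same way.
\<close>

section \<open>Total computable functionals\<close>

text \<open>The obstacle is well-foundedness: that a relation really compares the stages of an
  induction seems to be a statement about all descending sequences, and well-foundedness is not an
  arithmetical condition. The equation
  \<open>Y a b \<longleftrightarrow> a \<in> thin T {c. \<not> Y b c}\<close>, known from the stage
  comparison theorem for inductive definitions, avoids it: once the induction exhausts everything it
  has a single solution among all relations. Countability enters exactly there. The second
  constraint is that only one instance of unique choice may be used, so no answer can be processed
  and handed back for another query. All intermediate results are therefore packed into one point.
  The adjoined witnesses have to be the least ones, since otherwise this point would not be
  unique.\<close>

lemma eval_Comp1: "eval p g xs y \<Longrightarrow> eval p f [y] z \<Longrightarrow> eval p (Comp f [g]) xs z"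
  by (rule eval_Comp[of p xs _ "[y]"]) auto

lemma eval_Comp2:
  "eval p g xs x \<Longrightarrow> eval p h xs y \<Longrightarrow> eval p f [x, y] z \<Longrightarrow> eval p (Comp f [g, h]) xs z"
  by (rule eval_Comp[of p xs _ "[x, y]"]) auto

text \<open>Totality on every oracle is built in, so closure under composition and recursion carries
  no definedness conditions. Partiality is confined to \<open>computable\<close>.\<close>

definition recursive :: "nat \<Rightarrow> (baire \<Rightarrow> nat list \<Rightarrow> nat) \<Rightarrow> bool" where
  "recursive k f \<longleftrightarrow> (\<exists>e. \<forall>p xs. length xs = k \<longrightarrow> eval p e xs (f p xs))"

lemma recursiveI: "(\<And>p xs. length xs = k \<Longrightarrow> eval p e xs (f p xs)) \<Longrightarrow> recursive k f"
  unfolding recursive_def by blast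

lemma recursive_nth: "i < k \<Longrightarrow> recursive k (\<lambda>p xs. xs ! i)"
  by (rule recursiveI[of _ "Proj i"]) (simp add: eval_Proj)

lemma recursive_0: "recursive k (\<lambda>p xs. 0)"
  by (rule recursiveI[of _ Zero]) (simp add: eval_Zero)

lemma recursive_op1:
  assumes "\<And>p x. eval p e [x] (F p x)" "recursive k f"
  shows "recursive k (\<lambda>p xs. F p (f p xs))"
proof -
  obtain a where "\<And>p xs. length xs = k \<Longrightarrow> eval p a xs (f p xs)"
    using assms(2) unfolding recursive_def by blast
  with assms(1) show ?thesis by (intro recursiveI[of _ "Comp e [a]"]) (blast intro: eval_Comp1)
qed

lemma recursive_op2:
  assumes "\<And>p x y. eval p e [x, y] (F p x y)" "recursive k f" "recursive k g"
  shows "recursive k (\<lambda>p xs. F p (f p xs) (g p xs))"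
proof -
  obtain a b where "\<And>p xs. length xs = k \<Longrightarrow> eval p a xs (f p xs)"
    "\<And>p xs. length xs = k \<Longrightarrow> eval p b xs (g p xs)"
    using assms unfolding recursive_def by blast
  with assms(1) show ?thesis by (intro recursiveI[of _ "Comp e [a, b]"]) (blast intro: eval_Comp2)
qed

lemma recursive_Suc: "recursive k f \<Longrightarrow> recursive k (\<lambda>p xs. Suc (f p xs))"
  by (rule recursive_op1[of Succ]) (rule eval_Succ)

lemma recursive_oracle: "recursive k f \<Longrightarrow> recursive k (\<lambda>p xs. p (f p xs))"
  by (rule recursive_op1[of Oracle]) (rule eval_Oracle)

text \<open>Prepends a computed value to the arguments, so that a recursion can run up to a computed
  bound instead of up to its first argument.\<close>

lemma eval_Comp_args:
  assumes "eval p b xs y" "eval p f (y # xs) z"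
  shows "eval p (Comp f (b # map Proj [0..<length xs])) xs z"
proof (rule eval_Comp[where ys = "y # xs"])
  have "list_all2 (\<lambda>g y. eval p g xs y) (map Proj [0..<length xs]) (map ((!) xs) [0..<length xs])"
    by (auto simp: list_all2_conv_all_nth intro: eval_Proj)
  then show "list_all2 (\<lambda>g y. eval p g xs y) (b # map Proj [0..<length xs]) (y # xs)"
    using assms(1) by (simp add: map_nth)
qed (fact assms(2))

lemma recursive_rec_nat:
  assumes "recursive k a" "recursive (Suc (Suc k)) g" "recursive k b"
  shows "recursive k (\<lambda>p xs. rec_nat (a p xs) (\<lambda>m r. g p (m # r # xs)) (b p xs))"
proof -
  obtain ea eg eb where e: "\<And>p xs. length xs = k \<Longrightarrow> eval p ea xs (a p xs)"
    "\<And>p xs. length xs = Suc (Suc k) \<Longrightarrow> eval p eg xs (g p xs)"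
    "\<And>p xs. length xs = k \<Longrightarrow> eval p eb xs (b p xs)"
    using assms unfolding recursive_def by blast
  show ?thesis
  proof (rule recursiveI[of _ "Comp (PrimRec ea eg) (eb # map Proj [0..<k])"])
    fix p and xs :: "nat list" assume k: "length xs = k"
    have "eval p (PrimRec ea eg) (n # xs) (rec_nat (a p xs) (\<lambda>m r. g p (m # r # xs)) n)" for n
    proof (induction n)
      case 0
      then show ?case using e(1)[OF k] by (simp add: eval_PrimRec_0)
    next
      case (Suc n)
      then show ?case using e(2) k by (auto intro!: eval_PrimRec_Suc)
    qed
    then show "eval p (Comp (PrimRec ea eg) (eb # map Proj [0..<k])) xs
        (rec_nat (a p xs) (\<lambda>m r. g p (m # r # xs)) (b p xs))"
      using eval_Comp_args e(3)[OF k] k by blast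
  qed
qed

lemma eval_Mu_Least:
  assumes "\<And>n. eval p e (n # xs) (f n)" "\<exists>n. f n = 0"
  shows "eval p (Mu e) xs (LEAST n. f n = 0)"
proof (rule eval_Mu)
  show "eval p e ((LEAST n. f n = 0) # xs) 0"
    using assms(1)[of "LEAST n. f n = 0"] LeastI_ex[OF assms(2)] by simp
  fix m assume "m < (LEAST n. f n = 0)"
  then have "f m \<noteq> 0" by (rule not_less_Least)
  then show "\<exists>k. eval p e (m # xs) (Suc k)" using assms(1)[of m] by (cases "f m") auto
qed

lemma recursive_Least:
  assumes "recursive (Suc k) f" "\<And>p xs. \<exists>n. f p (n # xs) = 0"
  shows "recursive k (\<lambda>p xs. LEAST n. f p (n # xs) = 0)"
proof -
  obtain e where "\<And>p xs. length xs = Suc k \<Longrightarrow> eval p e xs (f p xs)"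
    using assms unfolding recursive_def by blast
  then show ?thesis using assms(2)
    by (intro recursiveI[of _ "Mu e"] eval_Mu_Least) auto
qed

section \<open>Elementary arithmetic and the Cantor pairing\<close>

lemma recursive_add:
  assumes "recursive k f" "recursive k g"
  shows "recursive k (\<lambda>p xs. f p xs + g p xs)"
proof (rule recursive_op2[OF _ assms])
  fix p x y show "eval p (PrimRec (Proj 0) (Comp Succ [Proj 1])) [x, y] (x + y)"
  proof (induction x)
    case 0
    show ?case using eval_Proj[of 0 "[y]" p] by (simp add: eval_PrimRec_0)
  next
    case (Suc x)
    show ?case
      using eval_Proj[of 1 "[x, x + y, y]" p] Suc
      by (auto intro!: eval_PrimRec_Suc[where r = "x + y"] eval_Comp1 eval_Succ)
  qed
qed

lemma recursive_pred:
  assumes "recursive k f"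
  shows "recursive k (\<lambda>p xs. f p xs - 1)"
proof (rule recursive_op1[OF _ assms])
  \<comment> \<open>The step program returns the counter, which is \<open>x\<close> when the value
    at \<open>Suc x\<close> is computed.\<close>
  fix p x show "eval p (PrimRec Zero (Proj 0)) [x] (x - 1)"
  proof (induction x)
    case 0
    show ?case by (simp add: eval_PrimRec_0 eval_Zero)
  next
    case (Suc x)
    show ?case
      using eval_Proj[of 0 "[x, x - 1]" p] Suc by (auto intro!: eval_PrimRec_Suc[where r = "x - 1"])
  qed
qed

lemma recursive_diff:
  assumes "recursive k f" "recursive k g"
  shows "recursive k (\<lambda>p xs. f p xs - g p xs)"
proof -
  have "recursive k (\<lambda>p xs. rec_nat (f p xs) (\<lambda>m r. (m # r # xs) ! 1 - 1) (g p xs))"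
    by (intro recursive_rec_nat[where g = "\<lambda>p ys. ys ! 1 - 1"] assms recursive_pred recursive_nth) simp
  moreover have "rec_nat a (\<lambda>m r. (m # r # xs) ! 1 - 1) b = a - b" for a b and xs :: "nat list"
    by (induction b) auto
  ultimately show ?thesis by simp
qed

lemma recursive_triangle:
  assumes "recursive k f"
  shows "recursive k (\<lambda>p xs. triangle (f p xs))"
proof -
  have "recursive k (\<lambda>p xs. rec_nat 0 (\<lambda>m r. (m # r # xs) ! 1 + Suc ((m # r # xs) ! 0)) (f p xs))"
    by (intro recursive_rec_nat[where g = "\<lambda>p ys. ys ! 1 + Suc (ys ! 0)"] assms recursive_add
        recursive_Suc recursive_nth recursive_0) simp_all
  moreover have "rec_nat 0 (\<lambda>m r. (m # r # xs) ! 1 + Suc ((m # r # xs) ! 0)) b = triangle b"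
    for b and xs :: "nat list"
    by (induction b) auto
  ultimately show ?thesis by simp
qed

definition enc :: "nat \<Rightarrow> nat \<Rightarrow> nat" where "enc a b = prod_encode (a, b)"
definition efst :: "nat \<Rightarrow> nat" where "efst n = fst (prod_decode n)"
definition esnd :: "nat \<Rightarrow> nat" where "esnd n = snd (prod_decode n)"

lemma efst_enc [simp]: "efst (enc a b) = a" and esnd_enc [simp]: "esnd (enc a b) = b"
  and enc_efst_esnd [simp]: "enc (efst n) (esnd n) = n"
  by (simp_all add: enc_def efst_def esnd_def)

lemma recursive_enc: "recursive k f \<Longrightarrow> recursive k g \<Longrightarrow> recursive k (\<lambda>p xs. enc (f p xs) (g p xs))"
  unfolding enc_def prod_encode_def prod.case by (intro recursive_add recursive_triangle)

text \<open>The antidiagonal of the Cantor pairing on which \<open>z\<close> lies, that is, the sum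
  of its two coordinates. The bound \<open>z < triangle (Suc s)\<close> is written as a vanishing
  truncated difference, the form in which \<open>Mu\<close> searches.\<close>

definition diag :: "nat \<Rightarrow> nat" where "diag z = (LEAST s. Suc z - triangle (Suc s) = 0)"

lemma triangle_mono: "m \<le> n \<Longrightarrow> triangle m \<le> triangle n"
  by (rule lift_Suc_mono_le[of triangle]) simp_all

lemma diag_enc: "diag (enc a b) = a + b"
  unfolding diag_def
proof (rule Least_equality)
  show "Suc (enc a b) - triangle (Suc (a + b)) = 0" by (simp add: enc_def prod_encode_def)
  fix s assume "Suc (enc a b) - triangle (Suc s) = 0"
  then have "triangle (a + b) < triangle (Suc s)" by (simp add: enc_def prod_encode_def)
  then show "a + b \<le> s" using triangle_mono[of "Suc s" "a + b"] by linarith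
qed

lemma recursive_diag:
  assumes "recursive k f"
  shows "recursive k (\<lambda>p xs. diag (f p xs))"
proof -
  have "recursive (Suc 0) (\<lambda>p xs. LEAST s. Suc ((s # xs) ! 1) - triangle (Suc ((s # xs) ! 0)) = 0)"
  proof (rule recursive_Least)
    show "recursive (Suc (Suc 0)) (\<lambda>p xs. Suc (xs ! 1) - triangle (Suc (xs ! 0)))"
      by (intro recursive_diff recursive_triangle recursive_Suc recursive_nth) simp_all
    \<comment> \<open>The search succeeds by the time it reaches the number itself, because
      \<open>triangle (Suc z)\<close> exceeds \<open>z\<close>.\<close>
    show "\<exists>n. Suc ((n # xs) ! 1) - triangle (Suc ((n # xs) ! 0)) = 0" for xs
      by (rule exI[of _ "(0 # xs) ! 1"]) simp
  qed
  then obtain e where "eval p e xs (diag (xs ! 0))" if "length xs = 1" for p xs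
    unfolding recursive_def diag_def by auto
  then have "eval p e [x] (diag x)" for p x by (metis One_nat_def length_Cons list.size(3) nth_Cons_0)
  then show ?thesis by (rule recursive_op1) (rule assms)
qed

lemma efst_eq: "efst n = n - triangle (diag n)" and esnd_eq: "esnd n = diag n - efst n"
proof -
  have d: "diag n = efst n + esnd n" using diag_enc[of "efst n" "esnd n"] by simp
  have "n = triangle (efst n + esnd n) + efst n"
    by (subst enc_efst_esnd[of n, symmetric], unfold enc_def prod_encode_def prod.case) (rule refl)
  then show "efst n = n - triangle (diag n)" using d by simp
  show "esnd n = diag n - efst n" using d by simp
qed

lemma recursive_efst: "recursive k f \<Longrightarrow> recursive k (\<lambda>p xs. efst (f p xs))"
  unfolding efst_eq by (intro recursive_diff recursive_triangle recursive_diag)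

lemma recursive_esnd: "recursive k f \<Longrightarrow> recursive k (\<lambda>p xs. esnd (f p xs))"
  unfolding esnd_eq by (intro recursive_diff recursive_efst recursive_diag)

subsection \<open>Unary functionals with coded arguments\<close>

text \<open>Packing all arguments into one number lets the closure rules apply by plain unification,
  without arities. A bound variable next to the argument \<open>n\<close> is reached as
  \<open>esnd c\<close> of a code \<open>c\<close> whose \<open>efst c\<close> is
  \<open>n\<close>.\<close>

definition cfun :: "(baire \<Rightarrow> nat \<Rightarrow> nat) \<Rightarrow> bool" where
  "cfun f \<longleftrightarrow> (\<exists>e. \<forall>p n. eval p e [n] (f p n))"

definition cpred :: "(baire \<Rightarrow> nat \<Rightarrow> bool) \<Rightarrow> bool" where
  "cpred P \<longleftrightarrow> cfun (\<lambda>p n. if P p n then 1 else 0)"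

lemma cfun_eq: "cfun f \<longleftrightarrow> recursive 1 (\<lambda>p xs. f p (xs ! 0))"
  unfolding cfun_def recursive_def
  by (metis One_nat_def length_0_conv length_Suc_conv nth_Cons_0)

lemma cfun_comp: "cfun F \<Longrightarrow> cfun f \<Longrightarrow> cfun (\<lambda>p n. F p (f p n))"
  unfolding cfun_def by (meson eval_Comp1)

lemma cpred_comp: "cpred P \<Longrightarrow> cfun f \<Longrightarrow> cpred (\<lambda>p n. P p (f p n))"
  unfolding cpred_def by (rule cfun_comp)

named_theorems cfun_intros

lemma cfun_id [cfun_intros]: "cfun (\<lambda>p n. n)"
  unfolding cfun_eq by (rule recursive_nth) simp

lemma cfun_Suc [cfun_intros]: "cfun f \<Longrightarrow> cfun (\<lambda>p n. Suc (f p n))"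
  unfolding cfun_eq by (rule recursive_Suc)

lemma cfun_const [cfun_intros]: "cfun (\<lambda>p n. c)"
  unfolding cfun_eq by (induction c) (intro recursive_0 recursive_Suc; assumption)+

lemma cfun_oracle [cfun_intros]: "cfun f \<Longrightarrow> cfun (\<lambda>p n. p (f p n))"
  unfolding cfun_eq by (rule recursive_oracle)

lemma cfun_add [cfun_intros]: "cfun f \<Longrightarrow> cfun g \<Longrightarrow> cfun (\<lambda>p n. f p n + g p n)"
  unfolding cfun_eq by (rule recursive_add)

lemma cfun_diff [cfun_intros]: "cfun f \<Longrightarrow> cfun g \<Longrightarrow> cfun (\<lambda>p n. f p n - g p n)"
  unfolding cfun_eq by (rule recursive_diff)

lemma cfun_enc [cfun_intros]: "cfun f \<Longrightarrow> cfun g \<Longrightarrow> cfun (\<lambda>p n. enc (f p n) (g p n))"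
  unfolding cfun_eq by (rule recursive_enc)

lemma cfun_efst [cfun_intros]: "cfun f \<Longrightarrow> cfun (\<lambda>p n. efst (f p n))"
  unfolding cfun_eq by (rule recursive_efst)

lemma cfun_esnd [cfun_intros]: "cfun f \<Longrightarrow> cfun (\<lambda>p n. esnd (f p n))"
  unfolding cfun_eq by (rule recursive_esnd)

lemma cfun_rec_nat [cfun_intros]:
  assumes "cfun a" "cfun (\<lambda>p c. g p (efst c) (efst (esnd c)) (esnd (esnd c)))" "cfun b"
  shows "cfun (\<lambda>p n. rec_nat (a p n) (\<lambda>m r. g p n m r) (b p n))"
proof -
  have "recursive 1 (\<lambda>p xs. rec_nat (a p (xs ! 0))
      (\<lambda>m r. g p ((m # r # xs) ! 2) ((m # r # xs) ! 0) ((m # r # xs) ! 1)) (b p (xs ! 0)))"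
  proof (rule recursive_rec_nat)
    obtain e where e: "eval p e [c] (g p (efst c) (efst (esnd c)) (esnd (esnd c)))" for p c
      using assms(2) unfolding cfun_def by blast
    have "recursive (Suc (Suc 1)) (\<lambda>p xs. g p (efst (enc (xs ! 2) (enc (xs ! 0) (xs ! 1))))
        (efst (esnd (enc (xs ! 2) (enc (xs ! 0) (xs ! 1))))) (esnd (esnd (enc (xs ! 2) (enc (xs ! 0) (xs ! 1))))))"
      by (rule recursive_op1[OF e]) (intro recursive_enc recursive_nth; simp)
    then show "recursive (Suc (Suc 1)) (\<lambda>p xs. g p (xs ! 2) (xs ! 0) (xs ! 1))" by simp
  qed (use assms in \<open>simp_all add: cfun_eq\<close>)
  then show ?thesis unfolding cfun_eq by simp
qed

lemma cfun_if [cfun_intros]: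
  assumes "cpred P" "cfun f" "cfun g"
  shows "cfun (\<lambda>p n. if P p n then f p n else g p n)"
proof -
  \<comment> \<open>A conditional is a recursion of length 0 or 1, run on the truth value.\<close>
  have "cfun (\<lambda>p n. rec_nat (g p n) (\<lambda>m r. f p n) (if P p n then 1 else 0))"
    by (intro cfun_intros assms(1)[unfolded cpred_def] cfun_comp[OF assms(2)] assms(3))
  then show ?thesis by (rule back_subst[of cfun]) (auto simp: fun_eq_iff)
qed

lemma cpred_const [cfun_intros]: "cpred (\<lambda>p n. b)"
  unfolding cpred_def by (rule cfun_const)

lemma cpred_not [cfun_intros]:
  assumes "cpred P" shows "cpred (\<lambda>p n. \<not> P p n)"
proof -
  have "cfun (\<lambda>p n. if P p n then 0 else 1)" by (intro cfun_intros assms)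
  then show ?thesis unfolding cpred_def by (rule back_subst[of cfun]) (auto simp: fun_eq_iff)
qed

lemma cpred_conj [cfun_intros]:
  assumes "cpred P" "cpred Q" shows "cpred (\<lambda>p n. P p n \<and> Q p n)"
proof -
  have "cfun (\<lambda>p n. if P p n then if Q p n then 1 else 0 else 0)"
    by (intro cfun_intros assms)
  then show ?thesis unfolding cpred_def by (rule back_subst[of cfun]) (auto simp: fun_eq_iff)
qed

lemma cpred_disj [cfun_intros]:
  assumes "cpred P" "cpred Q" shows "cpred (\<lambda>p n. P p n \<or> Q p n)"
proof -
  have "cpred (\<lambda>p n. \<not> (\<not> P p n \<and> \<not> Q p n))" by (intro cfun_intros assms)
  then show ?thesis by simp
qed

lemma cpred_imp [cfun_intros]:
  assumes "cpred P" "cpred Q" shows "cpred (\<lambda>p n. P p n \<longrightarrow> Q p n)"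
  unfolding imp_conv_disj by (intro cfun_intros assms)

lemma cpred_le [cfun_intros]:
  assumes "cfun f" "cfun g" shows "cpred (\<lambda>p n. f p n \<le> g p n)"
proof -
  have "cfun (\<lambda>p n. 1 - (f p n - g p n))" by (intro cfun_intros assms)
  then show ?thesis unfolding cpred_def by (rule back_subst[of cfun]) (auto simp: fun_eq_iff)
qed

lemma cpred_less [cfun_intros]:
  assumes "cfun f" "cfun g" shows "cpred (\<lambda>p n. f p n < g p n)"
  unfolding less_eq_Suc_le by (intro cfun_intros assms)

lemma cpred_eq [cfun_intros]:
  assumes "cfun f" "cfun g" shows "cpred (\<lambda>p n. f p n = g p n)"
  unfolding order_eq_iff by (intro cfun_intros assms)

lemma cpred_bex [cfun_intros]:
  assumes "cpred (\<lambda>p c. P p (efst c) (esnd c))" "cfun b"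
  shows "cpred (\<lambda>p n. \<exists>k<b p n. P p n k)"
proof -
  \<comment> \<open>Inside the recursion the data form a triple of argument, counter and previous
    value, so the bound variable has to be read off the second component of a triple.\<close>
  have "cpred (\<lambda>p n. P p (efst n) (efst (esnd n)))"
    using cpred_comp[OF assms(1), of "\<lambda>p n. enc (efst n) (efst (esnd n))"] by (simp add: cfun_intros)
  then have "cfun (\<lambda>p n. rec_nat 0 (\<lambda>m r. if r = 1 \<or> P p n m then 1 else 0) (b p n))"
    by (intro cfun_intros assms)
  moreover have "rec_nat 0 (\<lambda>m r. if r = 1 \<or> P p n m then 1 else 0) b = (if \<exists>k<b. P p n k then 1 else (0::nat))"
    for p n b
    by (induction b) (auto simp: less_Suc_eq)
  ultimately show ?thesis unfolding cpred_def by simp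
qed

lemma cpred_ball [cfun_intros]:
  assumes "cpred (\<lambda>p c. P p (efst c) (esnd c))" "cfun b"
  shows "cpred (\<lambda>p n. \<forall>k<b p n. P p n k)"
proof -
  have "cpred (\<lambda>p n. \<not> (\<exists>k<b p n. \<not> P p n k))" by (intro cfun_intros assms)
  then show ?thesis by simp
qed

lemma cfun_sum [cfun_intros]:
  assumes "cfun (\<lambda>p c. f p (efst c) (esnd c))" "cfun b"
  shows "cfun (\<lambda>p n. \<Sum>k<b p n. f p n k)"
proof -
  have "cfun (\<lambda>p n. f p (efst n) (efst (esnd n)))"
    using cfun_comp[OF assms(1), of "\<lambda>p n. enc (efst n) (efst (esnd n))"] by (simp add: cfun_intros)
  then have "cfun (\<lambda>p n. rec_nat 0 (\<lambda>m r. r + f p n m) (b p n))"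
    by (intro cfun_intros assms)
  moreover have "rec_nat 0 (\<lambda>m r. r + f p n m) b = (\<Sum>k<b. f p n k)" for p n b
    by (induction b) auto
  ultimately show ?thesis by simp
qed

text \<open>Yields a program rather than a \<open>cfun\<close>, because the search diverges where
  there is no witness. This partial form is what extracting a marked entry from a weak list
  requires.\<close>

lemma eval_Least:
  assumes "cpred P"
  obtains e where "\<And>p n. \<exists>k. P p (enc n k) \<Longrightarrow> eval p e [n] (LEAST k. P p (enc n k))"
proof -
  have "cpred (\<lambda>p c. \<not> P p c)" by (intro cfun_intros assms)
  then have "recursive 2 (\<lambda>p xs. if \<not> P p (enc (xs ! 1) (xs ! 0)) then 1 else 0)"
    unfolding cpred_def cfun_def
    by (elim exE) (rule recursive_op1, blast, intro recursive_enc recursive_nth, simp_all)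
  then obtain e where e: "eval p e [k, n] (if \<not> P p (enc n k) then 1 else 0)" for p n k
    unfolding recursive_def by (metis nth_Cons_0 nth_Cons_Suc One_nat_def length_Cons list.size(3) numeral_2_eq_2)
  show thesis
  proof
    fix p n assume ex: "\<exists>k. P p (enc n k)"
    have "eval p (Mu e) [n] (LEAST k. (if \<not> P p (enc n k) then 1 else 0::nat) = 0)"
      by (rule eval_Mu_Least) (use e ex in simp_all)
    moreover have "(if \<not> b then 1 else (0::nat)) = 0 \<longleftrightarrow> b" for b by simp
    ultimately show "eval p (Mu e) [n] (LEAST k. P p (enc n k))" by (simp only:)
  qed
qed

lemma cfun_Least:
  assumes "cpred (\<lambda>p c. P p (efst c) (esnd c))" "\<And>p n. \<exists>k. P p n k"
  shows "cfun (\<lambda>p n. LEAST k. P p n k)"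
proof -
  obtain e where "\<exists>k. P p (efst (enc n k)) (esnd (enc n k)) \<Longrightarrow>
      eval p e [n] (LEAST k. P p (efst (enc n k)) (esnd (enc n k)))" for p n
    using eval_Least[OF assms(1)] by blast
  then show ?thesis unfolding cfun_def using assms(2) by auto
qed

lemma cfun_div2 [cfun_intros]:
  assumes "cfun f" shows "cfun (\<lambda>p n. f p n div 2)"
proof -
  have "cfun (\<lambda>p n. LEAST k. n \<le> Suc (k + k))"
    by (rule cfun_Least) (intro cfun_intros, rule exI, rule trans_le_add2[THEN le_SucI], rule le_refl)
  moreover have "(LEAST k. n \<le> Suc (k + k)) = n div 2" for n :: nat
    by (rule Least_equality) auto
  ultimately show ?thesis using cfun_comp[of "\<lambda>p n. n div 2", OF _ assms] by simp
qed

lemma cpred_even [cfun_intros]: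
  assumes "cfun f" shows "cpred (\<lambda>p n. even (f p n))"
proof -
  have "cpred (\<lambda>p n. f p n = f p n div 2 + f p n div 2)" by (intro cfun_intros assms)
  moreover have "n = n div 2 + n div 2 \<longleftrightarrow> even n" for n :: nat by presburger
  ultimately show ?thesis by simp
qed

subsection \<open>Coded finite sequences\<close>

lemma case_list_decode:
  "(case list_decode c of [] \<Rightarrow> a | x # xs \<Rightarrow> g x xs) = (if c = 0 then a else g (efst (c - 1)) (list_decode (esnd (c - 1))))"
  by (cases c) (auto simp: efst_def esnd_def split: prod.split)

lemma list_decode_Suc_enc: "list_decode (Suc (enc x c)) = x # list_decode c"
  by (simp add: enc_def)

text \<open>A nonempty list has the successor of the pair of its head and tail as code, so one drop
  is a predecessor followed by \<open>esnd\<close>. The code 0 of the empty list is kept fixed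
  because \<open>esnd 0 = 0\<close>.\<close>

definition drop_code :: "nat \<Rightarrow> nat \<Rightarrow> nat" where
  "drop_code i c = rec_nat c (\<lambda>_ r. esnd (r - 1)) i"

definition nth_code :: "nat \<Rightarrow> nat \<Rightarrow> nat" where
  "nth_code c i = efst (drop_code i c - 1)"

lemma drop_code: "drop_code i c = list_encode (drop i (list_decode c))"
proof (induction i)
  case 0
  show ?case by (simp add: drop_code_def)
next
  case (Suc i)
  have tl: "list_encode (tl (list_decode d)) = esnd (d - 1)" for d
  proof (cases d)
    case 0
    then show ?thesis by (simp add: esnd_def prod_decode_def prod_decode_aux.simps)
  next
    case (Suc m)
    then show ?thesis by (simp add: esnd_def split: prod.split)
  qed
  have "drop_code (Suc i) c = esnd (drop_code i c - 1)" by (simp add: drop_code_def)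
  also have "\<dots> = list_encode (tl (drop i (list_decode c)))" using tl[of "drop_code i c"] by (simp add: Suc)
  finally show ?case by (simp add: drop_Suc tl_drop)
qed

lemma nth_code: "i < length (list_decode c) \<Longrightarrow> nth_code c i = list_decode c ! i"
  unfolding nth_code_def drop_code
  by (simp add: Cons_nth_drop_Suc[symmetric] efst_def)

lemma cfun_nth_code [cfun_intros]:
  "cfun f \<Longrightarrow> cfun g \<Longrightarrow> cfun (\<lambda>p n. nth_code (f p n) (g p n))"
  unfolding nth_code_def drop_code_def by (intro cfun_intros)

lemma cfun_length [cfun_intros]:
  assumes "cfun f" shows "cfun (\<lambda>p n. length (list_decode (f p n)))"
proof -
  have "cfun (\<lambda>p n. LEAST i. drop_code i n = 0)"
  proof (rule cfun_Least)
    show "cpred (\<lambda>p c. drop_code (esnd c) (efst c) = 0)"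
      unfolding drop_code_def by (intro cfun_intros)
    show "\<exists>k. drop_code k n = 0" for n
      unfolding drop_code by (rule exI[of _ "length (list_decode n)"]) simp
  qed
  moreover have "(LEAST i. drop_code i n = 0) = length (list_decode n)" for n
  proof -
    have "drop_code i n = 0 \<longleftrightarrow> length (list_decode n) \<le> i" for i
      unfolding drop_code by (metis drop_eq_Nil list_encode.simps(1) list_encode_eq)
    then show ?thesis by (auto intro: Least_equality)
  qed
  ultimately show ?thesis using cfun_comp[OF _ assms, of "\<lambda>p n. length (list_decode n)"] by simp
qed

section \<open>Finite approximations of oracle computations\<close>

text \<open>
  The value \<^term>\<open>Suc v\<close> means that the program outputs \<^term>\<open>v\<close> for every oracle
  \<^term>\<open>pair p y\<close> with \<^term>\<open>u\<close> an initial segment of \<^term>\<open>y\<close>; the value 0 means that this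
  is not yet known.  Unbounded search is cut off at the length of \<^term>\<open>u\<close>.
\<close>

fun approx :: "baire \<Rightarrow> nat list \<Rightarrow> prog \<Rightarrow> nat list \<Rightarrow> nat" where
  "approx p u Zero xs = 1"
| "approx p u Succ xs = (case xs of [] \<Rightarrow> 0 | x # _ \<Rightarrow> Suc (Suc x))"
| "approx p u (Proj i) xs = (if i < length xs then Suc (xs ! i) else 0)"
| "approx p u Oracle xs = (case xs of [] \<Rightarrow> 0 | x # _ \<Rightarrow>
    if even x then Suc (p (x div 2)) else if x div 2 < length u then Suc (u ! (x div 2)) else 0)"
| "approx p u (Comp f gs) xs =
    (if \<exists>g\<in>set gs. approx p u g xs = 0 then 0 else approx p u f (map (\<lambda>g. approx p u g xs - 1) gs))"
| "approx p u (PrimRec f g) xs = (case xs of [] \<Rightarrow> 0 | n # ys \<Rightarrow>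
    rec_nat (approx p u f ys) (\<lambda>m r. if r = 0 then 0 else approx p u g (m # (r - 1) # ys)) n)"
| "approx p u (Mu f) xs =
    (let k = LEAST n. n = length u \<or> approx p u f (n # xs) \<le> 1
     in if k < length u \<and> approx p u f (k # xs) = 1 then Suc k else 0)"

text \<open>The search in \<open>approx\<close> stops at the first argument whose value is unknown
  (0) or known to be zero (1), and only the second outcome counts as success. So success means that
  all earlier values are known and positive.\<close>

lemma approx_Mu_eq_Suc_iff:
  "approx p u (Mu f) xs = Suc k \<longleftrightarrow>
    k < length u \<and> approx p u f (k # xs) = 1 \<and> (\<forall>m<k. approx p u f (m # xs) > 1)" (is "_ \<longleftrightarrow> ?R")
proof -
  let ?P = "\<lambda>n. n = length u \<or> approx p u f (n # xs) \<le> 1"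
  have "(LEAST n. ?P n) = k" if ?R
    using that by (intro Least_equality) (auto, metis leD leI)
  moreover have "approx p u f (m # xs) > 1" if "m < (LEAST n. ?P n)" for m
    using not_less_Least[OF that] by simp
  ultimately show ?thesis by (auto simp: Let_def)
qed

text \<open>A known answer rests only on answers that are themselves known, and a longer segment
  keeps these. Hence refuted nodes stay refuted under extension, and the remaining nodes form a
  tree.\<close>

lemma approx_mono: "approx p u e xs = Suc v \<Longrightarrow> approx p (u @ w) e xs = Suc v"
proof (induction e arbitrary: xs v)
  case (Comp f gs)
  from Comp.prems have nz: "\<forall>g\<in>set gs. approx p u g xs \<noteq> 0"
    and v: "approx p u f (map (\<lambda>g. approx p u g xs - 1) gs) = Suc v" by (auto split: if_splits)
  have "approx p (u @ w) g xs = approx p u g xs" if "g \<in> set gs" for g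
    using Comp.IH(2)[OF that] nz that by (metis not0_implies_Suc)
  then have "map (\<lambda>g. approx p (u @ w) g xs - 1) gs = map (\<lambda>g. approx p u g xs - 1) gs"
    "\<forall>g\<in>set gs. approx p (u @ w) g xs \<noteq> 0" using nz by auto
  with Comp.IH(1)[OF v] show ?case by (simp only: approx.simps) simp
next
  case (PrimRec f g)
  from PrimRec.prems obtain n ys where xs: "xs = n # ys" by (cases xs) auto
  have "rec_nat (approx p (u @ w) f ys) (\<lambda>m r. if r = 0 then 0 else approx p (u @ w) g (m # (r - 1) # ys)) n = Suc v"
    if "rec_nat (approx p u f ys) (\<lambda>m r. if r = 0 then 0 else approx p u g (m # (r - 1) # ys)) n = Suc v" for v
    using that
  proof (induction n arbitrary: v)
    case 0
    then show ?case using PrimRec.IH(1) by simp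
  next
    case (Suc n)
    from Suc.prems obtain r
      where r: "rec_nat (approx p u f ys) (\<lambda>m r. if r = 0 then 0 else approx p u g (m # (r - 1) # ys)) n = Suc r"
      by (auto split: if_splits simp: gr0_conv_Suc)
    with Suc.prems have "approx p u g (n # r # ys) = Suc v" by simp
    then show ?case using Suc.IH[OF r] PrimRec.IH(2) by simp
  qed
  then show ?case using PrimRec.prems xs by simp
next
  case (Mu f)
  from Mu.prems have k: "v < length u" "approx p u f (v # xs) = Suc 0"
      "\<And>m. m < v \<Longrightarrow> approx p u f (m # xs) > 1"
    unfolding approx_Mu_eq_Suc_iff by auto
  have "approx p (u @ w) f (m # xs) > 1" if m: "m < v" for m
  proof -
    obtain l where "approx p u f (m # xs) = Suc (Suc l)"
      using k(3)[OF m] by (auto simp: less_iff_Suc_add)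
    from Mu.IH[OF this] show ?thesis by simp
  qed
  with k Mu.IH show ?case unfolding approx_Mu_eq_Suc_iff by simp
qed (auto split: list.splits if_splits simp: nth_append)

lemma approx_sound:
  assumes "\<And>i. i < length u \<Longrightarrow> u ! i = y i"
  shows "approx p u e xs = Suc v \<Longrightarrow> eval (pair p y) e xs v"
proof (induction e arbitrary: xs v)
  case Zero
  then show ?case by (auto intro: eval_Zero)
next
  case Succ
  then show ?case by (auto split: list.splits intro: eval_Succ)
next
  case (Proj i)
  then show ?case by (auto split: if_splits intro: eval_Proj)
next
  case Oracle
  then obtain x ys where x: "xs = x # ys" by (cases xs) auto
  with Oracle assms have "v = pair p y x" by (auto split: if_splits simp: pair_def)
  then show ?case using x by (simp add: eval_Oracle)
next
  case (Comp f gs)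
  from Comp.prems have nz: "\<forall>g\<in>set gs. approx p u g xs \<noteq> 0"
    and v: "approx p u f (map (\<lambda>g. approx p u g xs - 1) gs) = Suc v" by (auto split: if_splits)
  have "eval (pair p y) g xs (approx p u g xs - 1)" if "g \<in> set gs" for g
    using Comp.IH(2)[OF that] nz that by simp
  then have "list_all2 (\<lambda>g y'. eval (pair p y) g xs y') gs (map (\<lambda>g. approx p u g xs - 1) gs)"
    by (simp add: list_all2_conv_all_nth)
  then show ?case using Comp.IH(1)[OF v] by (rule eval_Comp)
next
  case (PrimRec f g)
  from PrimRec.prems obtain n ys where xs: "xs = n # ys" by (cases xs) auto
  have "eval (pair p y) (PrimRec f g) (n # ys) v"
    if "rec_nat (approx p u f ys) (\<lambda>m r. if r = 0 then 0 else approx p u g (m # (r - 1) # ys)) n = Suc v" for v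
    using that
  proof (induction n arbitrary: v)
    case 0
    then show ?case using PrimRec.IH(1) by (simp add: eval_PrimRec_0)
  next
    case (Suc n)
    from Suc.prems obtain r
      where r: "rec_nat (approx p u f ys) (\<lambda>m r. if r = 0 then 0 else approx p u g (m # (r - 1) # ys)) n = Suc r"
      by (auto split: if_splits simp: gr0_conv_Suc)
    with Suc.prems have "approx p u g (n # r # ys) = Suc v" by simp
    then show ?case using Suc.IH[OF r] PrimRec.IH(2) by (blast intro: eval_PrimRec_Suc)
  qed
  then show ?case using PrimRec.prems xs by simp
next
  case (Mu f)
  from Mu.prems have k: "approx p u f (v # xs) = Suc 0"
      "\<And>m. m < v \<Longrightarrow> approx p u f (m # xs) > 1"
    unfolding approx_Mu_eq_Suc_iff by auto
  show ?case
  proof (rule eval_Mu)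
    show "eval (pair p y) f (v # xs) 0" using Mu.IH k(1) by blast
    fix m assume "m < v"
    from k(2)[OF this] obtain k where "approx p u f (m # xs) = Suc (Suc k)" by (auto simp: less_iff_Suc_add)
    then show "\<exists>k. eval (pair p y) f (m # xs) (Suc k)" using Mu.IH by blast
  qed
qed

lemma approx_map_mono:
  assumes "approx p (map y [0..<m]) e xs = Suc v" "m \<le> m'"
  shows "approx p (map y [0..<m']) e xs = Suc v"
proof -
  have "map y [0..<m'] = map y [0..<m] @ map y [m..<m']"
    using assms(2) by (metis le0 le_add_diff_inverse map_append upt_add_eq_append)
  then show ?thesis using approx_mono[OF assms(1)] by simp
qed

text \<open>A terminating computation consults its oracle finitely often; segments for the
  subcomputations are merged by taking the maximum of their lengths.\<close>

lemma approx_complete: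
  assumes "eval q e xs v" "q = pair p y"
  shows "\<exists>m. approx p (map y [0..<m]) e xs = Suc v"
  using assms
proof (induction rule: eval.induct)
  case (eval_Oracle x xs)
  show ?case by (rule exI[of _ "Suc (x div 2)"]) (auto simp: eval_Oracle pair_def simp del: upt_Suc)
next
  case (eval_Comp xs gs ys f z)
  have "\<exists>m. \<forall>i<j. approx p (map y [0..<m]) (gs ! i) xs = Suc (ys ! i)" if "j \<le> length gs" for j
    using that
  proof (induction j)
    case (Suc j)
    then obtain m where m: "\<forall>i<j. approx p (map y [0..<m]) (gs ! i) xs = Suc (ys ! i)" by auto
    from list_all2_nthD[OF eval_Comp.IH(1), of j] eval_Comp.prems Suc.prems
    obtain m' where "approx p (map y [0..<m']) (gs ! j) xs = Suc (ys ! j)" by auto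
    then have "\<forall>i<Suc j. approx p (map y [0..<max m m']) (gs ! i) xs = Suc (ys ! i)"
      using m by (auto simp: less_Suc_eq intro: approx_map_mono)
    then show ?case by blast
  qed simp
  then obtain m where m: "\<forall>i<length gs. approx p (map y [0..<m]) (gs ! i) xs = Suc (ys ! i)" by blast
  from eval_Comp.IH(2) eval_Comp.prems obtain m' where m': "approx p (map y [0..<m']) f ys = Suc z" by blast
  let ?u = "map y [0..<max m m']"
  have g: "\<forall>i<length gs. approx p ?u (gs ! i) xs = Suc (ys ! i)"
    using m by (auto intro: approx_map_mono)
  have "map (\<lambda>g. approx p ?u g xs - 1) gs = ys"
    using g list_all2_lengthD[OF eval_Comp.IH(1)] by (auto intro: nth_equalityI)
  moreover have "\<not> (\<exists>g\<in>set gs. approx p ?u g xs = 0)" using g by (auto simp: in_set_conv_nth)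
  moreover have "approx p ?u f ys = Suc z" using m' by (rule approx_map_mono) simp
  ultimately have "approx p ?u (Comp f gs) xs = Suc z" by (simp only: approx.simps if_False)
  then show ?case by blast
next
  case (eval_PrimRec_Suc f g n xs r z)
  then obtain m m' where m: "approx p (map y [0..<m]) (PrimRec f g) (n # xs) = Suc r"
    "approx p (map y [0..<m']) g (n # r # xs) = Suc z" by blast
  let ?u = "map y [0..<max m m']"
  have "approx p ?u (PrimRec f g) (n # xs) = Suc r" "approx p ?u g (n # r # xs) = Suc z"
    using m by (blast intro: approx_map_mono max.cobounded1 max.cobounded2)+
  then have "approx p ?u (PrimRec f g) (Suc n # xs) = Suc z" by simp
  then show ?case by blast
next
  case (eval_Mu f n xs)
  then obtain m where m: "approx p (map y [0..<m]) f (n # xs) = Suc 0" by blast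
  have "\<exists>m. \<forall>i<j. approx p (map y [0..<m]) f (i # xs) > 1" if "j \<le> n" for j
    using that
  proof (induction j)
    case (Suc j)
    then obtain m where m: "\<forall>i<j. approx p (map y [0..<m]) f (i # xs) > 1" by auto
    from eval_Mu.IH(2)[of j] eval_Mu.prems Suc.prems
    obtain m' k where m': "approx p (map y [0..<m']) f (j # xs) = Suc (Suc k)" by auto
    have "approx p (map y [0..<max m m']) f (i # xs) > 1" if i: "i < Suc j" for i
    proof (cases "i = j")
      case True
      have "approx p (map y [0..<max m m']) f (j # xs) = Suc (Suc k)" using m' by (rule approx_map_mono) simp
      then show ?thesis using True by simp
    next
      case False
      then have "approx p (map y [0..<m]) f (i # xs) > 1" using m i by simp
      then obtain l where l: "approx p (map y [0..<m]) f (i # xs) = Suc (Suc l)" by (auto simp: less_iff_Suc_add)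
      have "approx p (map y [0..<max m m']) f (i # xs) = Suc (Suc l)" using l by (rule approx_map_mono) simp
      then show ?thesis by simp
    qed
    then show ?case by blast
  qed simp
  then obtain m' where m': "\<forall>i<n. approx p (map y [0..<m']) f (i # xs) > 1" by blast
  \<comment> \<open>\<open>Suc n\<close> is included because the approximate search is cut off at
    the length of the segment and must still reach \<open>n\<close>.\<close>
  let ?k = "max (Suc n) (max m m')"
  have "approx p (map y [0..<?k]) f (n # xs) = 1" using approx_map_mono[OF m, of ?k] by simp
  moreover have "approx p (map y [0..<?k]) f (i # xs) > 1" if i: "i < n" for i
  proof -
    obtain l where l: "approx p (map y [0..<m']) f (i # xs) = Suc (Suc l)" using m' i by (auto simp: less_iff_Suc_add)
    have "approx p (map y [0..<?k]) f (i # xs) = Suc (Suc l)" using l by (rule approx_map_mono) simp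
    then show ?thesis by simp
  qed
  ultimately have "approx p (map y [0..<?k]) (Mu f) xs = Suc n"
    unfolding approx_Mu_eq_Suc_iff by simp
  then show ?case by blast
qed auto

text \<open>The program \<open>e\<close> is fixed, so a separate functional is built for each
  \<open>e\<close> by recursion on its syntax, in place of an interpreter for coded
  programs.\<close>

lemma cfun_approx: "cfun (\<lambda>p c. approx p (list_decode (efst c)) e (list_decode (esnd c)))"
proof (induction e)
  case Zero
  then show ?case unfolding approx.simps by (intro cfun_intros)
next
  case Succ
  then show ?case unfolding approx.simps case_list_decode by (intro cfun_intros)
next
  case (Proj i)
  have "cfun (\<lambda>p c. if i < length (list_decode (esnd c)) then Suc (nth_code (esnd c) i) else 0)"
    by (intro cfun_intros)
  then show ?case by (rule back_subst[of cfun]) (auto simp: fun_eq_iff nth_code)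
next
  case Oracle
  have "cfun (\<lambda>p c. if esnd c = 0 then 0 else if even (efst (esnd c - 1)) then Suc (p (efst (esnd c - 1) div 2))
      else if efst (esnd c - 1) div 2 < length (list_decode (efst c))
      then Suc (nth_code (efst c) (efst (esnd c - 1) div 2)) else 0)"
    by (intro cfun_intros)
  then show ?case unfolding approx.simps case_list_decode
    by (rule back_subst[of cfun]) (auto simp: fun_eq_iff nth_code)
next
  case (Comp f gs)
  have "cpred (\<lambda>p c. \<exists>g\<in>set gs. approx p (list_decode (efst c)) g (list_decode (esnd c)) = 0)"
    using Comp.IH(2)
  proof (induction gs)
    case Nil
    show ?case by (simp add: cpred_const)
  next
    case (Cons g gs)
    then have "cpred (\<lambda>p c. approx p (list_decode (efst c)) g (list_decode (esnd c)) = 0 \<or>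
        (\<exists>g\<in>set gs. approx p (list_decode (efst c)) g (list_decode (esnd c)) = 0))"
      by (intro cfun_intros) auto
    then show ?case by simp
  qed
  moreover have "cfun (\<lambda>p c. list_encode (map (\<lambda>g. approx p (list_decode (efst c)) g (list_decode (esnd c)) - 1) gs))"
    (is "cfun ?G") using Comp.IH(2)
  proof (induction gs)
    case Nil
    show ?case by (simp add: cfun_const)
  next
    case (Cons g gs)
    then have "cfun (\<lambda>p c. Suc (enc (approx p (list_decode (efst c)) g (list_decode (esnd c)) - 1)
        (list_encode (map (\<lambda>g. approx p (list_decode (efst c)) g (list_decode (esnd c)) - 1) gs))))"
      by (intro cfun_intros) auto
    then show ?case by (simp add: enc_def)
  qed
  then have "cfun (\<lambda>p c. enc (efst c) (?G p c))" by (intro cfun_intros)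
  from cfun_comp[OF Comp.IH(1) this]
  have "cfun (\<lambda>p c. approx p (list_decode (efst c)) f
      (map (\<lambda>g. approx p (list_decode (efst c)) g (list_decode (esnd c)) - 1) gs))" by simp
  ultimately show ?case unfolding approx.simps by (intro cfun_intros)
next
  case (PrimRec f g)
  have f: "cfun (\<lambda>p c. approx p (list_decode (efst c)) f (list_decode (esnd (esnd c - 1))))"
    using cfun_comp[OF PrimRec.IH(1), of "\<lambda>p c. enc (efst c) (esnd (esnd c - 1))"] by (simp add: cfun_intros)
  have g: "cfun (\<lambda>p d. approx p (list_decode (efst (efst d))) g
      (efst (esnd d) # (esnd (esnd d) - 1) # list_decode (esnd (esnd (efst d) - 1))))"
    using cfun_comp[OF PrimRec.IH(2), of "\<lambda>p d. enc (efst (efst d))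
        (Suc (enc (efst (esnd d)) (Suc (enc (esnd (esnd d) - 1) (esnd (esnd (efst d) - 1))))))"]
    unfolding efst_enc esnd_enc list_decode_Suc_enc by (simp add: cfun_intros)
  show ?case unfolding approx.simps case_list_decode by (intro cfun_intros f g)
next
  case (Mu f)
  have f: "cfun (\<lambda>p d. approx p (list_decode (efst (efst d))) f (esnd d # list_decode (esnd (efst d))))"
    using cfun_comp[OF Mu.IH, of "\<lambda>p d. enc (efst (efst d)) (Suc (enc (esnd d) (esnd (efst d))))"]
    unfolding efst_enc esnd_enc list_decode_Suc_enc by (simp add: cfun_intros)
  let ?k = "\<lambda>p c. LEAST n. n = length (list_decode (efst c)) \<or>
      approx p (list_decode (efst c)) f (n # list_decode (esnd c)) \<le> 1"
  have k: "cfun ?k" by (rule cfun_Least) (intro cfun_intros f, blast)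
  have "cfun (\<lambda>p c. enc c (?k p c))" by (intro cfun_intros k)
  from cfun_comp[OF f this]
  have "cfun (\<lambda>p c. approx p (list_decode (efst c)) f (?k p c # list_decode (esnd c)))"
    by (simp only: efst_enc esnd_enc)
  then show ?case unfolding approx.simps Let_def by (intro cfun_intros k)
qed

text \<open>The tree refutes \<^term>\<open>y\<close> as soon as a finite part of it yields the value 0.\<close>

lemma Pi01_closed_name:
  assumes "cpred P"
  obtains H where "cfun H" "\<And>p. closed_rep (H p) = Some {y. \<forall>n. P (pair p y) n}"
proof -
  obtain e where e: "eval q e [n] (if P q n then 1 else 0)" for q n
    using assms unfolding cpred_def cfun_def by blast
  \<comment> \<open>\<open>Suc 0\<close> is the known answer "false". Testing only
    \<open>n < length u\<close> keeps membership decidable, while along an infinite path every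
    \<open>n\<close> is tested sooner or later.\<close>
  define T where "T p = {u. \<forall>n<length u. approx p u e [n] \<noteq> Suc 0}" for p
  define H where "H p c = (if list_decode c \<in> T p then 1 else 0::nat)" for p c
  have "cfun (\<lambda>p d. approx p (list_decode (efst d)) e [esnd d])"
    using cfun_comp[OF cfun_approx[of e], of "\<lambda>p d. enc (efst d) (Suc (enc (esnd d) 0))"]
    unfolding efst_enc esnd_enc list_decode_Suc_enc by (simp add: cfun_intros)
  then have "cfun (\<lambda>p c. if \<forall>n<length (list_decode c). approx p (list_decode c) e [n] \<noteq> Suc 0 then 1 else 0)"
    by (intro cfun_intros)
  then have "cfun H" unfolding H_def T_def by simp
  moreover have "closed_rep (H p) = Some {y. \<forall>n. P (pair p y) n}" for p
    unfolding closed_rep_eq_Some_iff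
  proof (intro exI conjI)
    show "is_tree (T p)"
      unfolding is_tree_def T_def
    proof (intro allI impI, rule CollectI, intro allI impI notI)
      fix u v n
      assume "u @ v \<in> {u. \<forall>n<length u. approx p u e [n] \<noteq> Suc 0}"
        and "n < length u" "approx p u e [n] = Suc 0"
      then show False using approx_mono[of p u e "[n]" 0 v] by auto
    qed
    show "H p = (\<lambda>k. if list_decode k \<in> T p then 1 else 0)" by (simp add: H_def fun_eq_iff)
    show "{y. \<forall>n. P (pair p y) n} = paths (T p)"
    proof (intro set_eqI iffI)
      fix y assume y: "y \<in> {y. \<forall>n. P (pair p y) n}"
      have "approx p (map y [0..<m]) e [n] \<noteq> Suc 0" for m n
      proof
        assume "approx p (map y [0..<m]) e [n] = Suc 0"
        then have "eval (pair p y) e [n] 0" by (rule approx_sound[rotated]) simp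
        from eval_functional[OF this e] show False using y by auto
      qed
      then show "y \<in> paths (T p)" by (simp add: paths_def T_def)
    next
      fix y assume y: "y \<in> paths (T p)"
      have "P (pair p y) n" for n
      proof (rule ccontr)
        assume "\<not> P (pair p y) n"
        then obtain m where m: "approx p (map y [0..<m]) e [n] = Suc 0"
          using approx_complete[OF e[of "pair p y" n] refl] by auto
        \<comment> \<open>Lengthened to at least \<open>Suc n\<close>, so that the node is one that
          tests \<open>n\<close>.\<close>
        have "approx p (map y [0..<max m (Suc n)]) e [n] = Suc 0"
          using m by (rule approx_map_mono) simp
        moreover have "map y [0..<max m (Suc n)] \<in> T p" using y by (simp add: paths_def)
        ultimately show False by (auto simp: T_def)
      qed
      then show "y \<in> {y. \<forall>n. P (pair p y) n}" by blast
    qed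
  qed
  ultimately show thesis by (rule that)
qed

section \<open>Composition of functionals\<close>

fun subst_oracle :: "prog \<Rightarrow> prog \<Rightarrow> prog" where
  "subst_oracle a Oracle = Comp a [Proj 0]"
| "subst_oracle a (Comp f gs) = Comp (subst_oracle a f) (map (subst_oracle a) gs)"
| "subst_oracle a (PrimRec f g) = PrimRec (subst_oracle a f) (subst_oracle a g)"
| "subst_oracle a (Mu f) = Mu (subst_oracle a f)"
| "subst_oracle a Zero = Zero"
| "subst_oracle a Succ = Succ"
| "subst_oracle a (Proj i) = Proj i"

lemma eval_subst_oracle:
  assumes "eval q e xs v" "\<And>x. eval p a [x] (q x)"
  shows "eval p (subst_oracle a e) xs v"
  using assms(1)
proof (induction rule: eval.induct)
  case (eval_Oracle x xs)
  show ?case using eval_Proj[of 0 "x # xs" p] assms(2) by (auto intro: eval_Comp1)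
next
  case (eval_Comp xs gs ys f z)
  then show ?case
    by (auto intro!: eval.eval_Comp[where ys = ys] simp: list_all2_conv_all_nth)
next
  case (eval_Mu f n xs)
  then show ?case by (auto intro!: eval.eval_Mu)
qed (auto intro: eval.intros)

lemma cfun_subst:
  assumes "cfun F" "cfun A" "cfun a"
  shows "cfun (\<lambda>p n. F (A p) (a p n))"
proof -
  obtain e where e: "eval q e [n] (F q n)" for q n using assms(1) unfolding cfun_def by blast
  obtain b where "eval p b [n] (A p n)" for p n using assms(2) unfolding cfun_def by blast
  with e have "eval p (subst_oracle b e) [n] (F (A p) n)" for p n by (blast intro: eval_subst_oracle)
  then have "cfun (\<lambda>p n. F (A p) n)" unfolding cfun_def by blast
  from cfun_comp[OF this assms(3)] show ?thesis .
qed

definition left :: "baire \<Rightarrow> baire" where "left q = (\<lambda>n. q (n + n))"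
definition right :: "baire \<Rightarrow> baire" where "right q = (\<lambda>n. q (Suc (n + n)))"

lemma left_pair [simp]: "left (pair p q) = p" and right_pair [simp]: "right (pair p q) = q"
  by (simp_all add: left_def right_def pair_def fun_eq_iff flip: mult_2)

lemma pair_left_right [simp]: "pair (left q) (right q) = q"
proof
  fix n show "pair (left q) (right q) n = q n"
    by (cases "even n") (auto simp: left_def right_def pair_def elim!: evenE oddE simp flip: mult_2)
qed

lemma eq_pair_iff: "z = pair p q \<longleftrightarrow> left z = p \<and> right z = q"
  by (metis left_pair right_pair pair_left_right)

lemma cfun_left [cfun_intros]: "cfun A \<Longrightarrow> cfun i \<Longrightarrow> cfun (\<lambda>p n. left (A p) (i p n))"
  unfolding left_def by (rule cfun_comp[of A]) (assumption | intro cfun_intros)+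

lemma cfun_right [cfun_intros]: "cfun A \<Longrightarrow> cfun i \<Longrightarrow> cfun (\<lambda>p n. right (A p) (i p n))"
  unfolding right_def by (rule cfun_comp[of A]) (assumption | intro cfun_intros)+

lemma cfun_pair [cfun_intros]:
  assumes "cfun A" "cfun B" "cfun i"
  shows "cfun (\<lambda>p n. pair (A p) (B p) (i p n))"
  unfolding pair_def by (intro cfun_if cpred_even cfun_comp[OF assms(1)] cfun_comp[OF assms(2)] cfun_div2 assms(3))

lemma cpred_subst:
  assumes "cpred P" "cfun A" "cfun a"
  shows "cpred (\<lambda>p n. P (A p) (a p n))"
  using cfun_subst[OF assms(1)[unfolded cpred_def] assms(2,3)] unfolding cpred_def .

section \<open>Weihrauch reducibility\<close>

lemma cfun_computable: "cfun F \<Longrightarrow> computable (\<lambda>p. Some (F p))"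
  unfolding cfun_def computable_def by auto

lemma computable_bind:
  assumes "computable F" "computable G"
  shows "computable (\<lambda>p. Option.bind (F p) G)"
proof -
  obtain a b where a: "F p = Some q \<Longrightarrow> eval p a [n] (q n)" and b: "G p = Some q \<Longrightarrow> eval p b [n] (q n)"
    for p q n using assms unfolding computable_def by blast
  show ?thesis
    unfolding computable_def
  proof (intro exI allI impI)
    fix p q n assume "Option.bind (F p) G = Some q"
    then obtain r where "F p = Some r" "G r = Some q" by (auto simp: bind_eq_Some_conv)
    then show "eval p (subst_oracle a b) [n] (q n)" using a b by (blast intro: eval_subst_oracle)
  qed
qed

lemma computable_cfun_comp:
  assumes "cfun A" "computable G"
  shows "computable (\<lambda>p. G (A p))"
  using computable_bind[OF cfun_computable[OF assms(1)] assms(2)] by simp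

text \<open>\<open>Comp\<close> is strict, so both components are evaluated at
  \<open>n div 2\<close> before the parity selects one. This is harmless: whenever the pair is
  defined, both component programs are total.\<close>

lemma computable_pair:
  assumes "computable F" "computable G"
  shows "computable (\<lambda>p. Option.bind (F p) (\<lambda>q. Option.bind (G p) (\<lambda>r. Some (pair q r))))"
proof -
  obtain a b where a: "F p = Some q \<Longrightarrow> eval p a [n] (q n)" and b: "G p = Some q \<Longrightarrow> eval p b [n] (q n)"
    for p q n using assms unfolding computable_def by blast
  have "cfun (\<lambda>p c. if even (efst c) then efst (esnd c) else esnd (esnd c))" "cfun (\<lambda>p n. n div 2)"
    by (intro cfun_intros)+
  then obtain c h where c: "eval p c [k] (if even (efst k) then efst (esnd k) else esnd (esnd k))"
    and h: "eval p h [n] (n div 2)" for p k n unfolding cfun_def by blast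
  have "recursive 3 (\<lambda>p xs. enc (xs ! 0) (enc (xs ! 1) (xs ! 2)))"
    by (intro recursive_enc recursive_nth) simp_all
  then obtain d where "\<forall>p xs. length xs = 3 \<longrightarrow> eval p d xs (enc (xs ! 0) (enc (xs ! 1) (xs ! 2)))"
    unfolding recursive_def by blast
  from this[rule_format, of "[x, y, z]" for x y z]
  have d: "eval p d [x, y, z] (enc x (enc y z))" for p x y z by simp
  let ?e = "Comp c [Comp d [Proj 0, Comp a [h], Comp b [h]]]"
  show ?thesis
    unfolding computable_def
  proof (intro exI[of _ ?e] allI impI)
    fix p s n assume "Option.bind (F p) (\<lambda>q. Option.bind (G p) (\<lambda>r. Some (pair q r))) = Some s"
    then obtain q r where q: "F p = Some q" "G p = Some r" "s = pair q r"
      by (auto simp: bind_eq_Some_conv)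
    have "eval p (Proj 0) [n] n" using eval_Proj[of 0 "[n]" p] by simp
    moreover have "eval p (Comp a [h]) [n] (q (n div 2))" "eval p (Comp b [h]) [n] (r (n div 2))"
      using a b q h by (blast intro: eval_Comp1)+
    ultimately have "eval p (Comp d [Proj 0, Comp a [h], Comp b [h]]) [n] (enc n (enc (q (n div 2)) (r (n div 2))))"
      by (intro eval_Comp[where ys = "[n, q (n div 2), r (n div 2)]"] d) simp
    from eval_Comp1[OF this c] show "eval p ?e [n] (s n)" unfolding q pair_def efst_enc esnd_enc .
  qed
qed

lemma weihrauch_le_trans:
  assumes "f \<le>\<^sub>W g" "g \<le>\<^sub>W h"
  shows "f \<le>\<^sub>W h"
proof -
  obtain H1 K1 where 1: "computable H1" "computable K1"
    "\<And>G. realizes G g \<Longrightarrow>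
      realizes (\<lambda>p. Option.bind (H1 p) (\<lambda>q. Option.bind (G q) (\<lambda>r. K1 (pair p r)))) f"
    using assms(1) unfolding weihrauch_le_def by blast
  obtain H2 K2 where 2: "computable H2" "computable K2"
    "\<And>G. realizes G h \<Longrightarrow>
      realizes (\<lambda>p. Option.bind (H2 p) (\<lambda>q. Option.bind (G q) (\<lambda>r. K2 (pair p r)))) g"
    using assms(2) unfolding weihrauch_le_def by blast
  let ?H = "\<lambda>p. Option.bind (H1 p) H2"
  \<comment> \<open>The answer to \<open>h\<close> comes with the original input only, so the
    intermediate input \<open>H1 p\<close>, which \<open>K2\<close> expects, has to be computed
    again.\<close>
  let ?A = "\<lambda>q. Option.bind (H1 (left q)) (\<lambda>a. Option.bind (Some (right q)) (\<lambda>r. Some (pair a r)))"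
  let ?B = "\<lambda>q. Option.bind (?A q) K2"
  let ?C = "\<lambda>q. Option.bind (Some (left q)) (\<lambda>a. Option.bind (?B q) (\<lambda>r. Some (pair a r)))"
  let ?K = "\<lambda>q. Option.bind (?C q) K1"
  have lr: "cfun left" "cfun right"
    using cfun_left[OF cfun_oracle[OF cfun_id] cfun_id] cfun_right[OF cfun_oracle[OF cfun_id] cfun_id]
    by simp_all
  have "computable ?H" using 1 2 by (intro computable_bind)
  moreover have "computable ?K"
    by (intro computable_bind[OF _ 1(2)] computable_pair computable_bind[OF _ 2(2)]
        computable_cfun_comp[OF _ 1(1)] cfun_computable lr)
  moreover have "realizes (\<lambda>p. Option.bind (?H p) (\<lambda>q. Option.bind (G q) (\<lambda>r. ?K (pair p r)))) f"
    if "realizes G h" for G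
  proof -
    have "Option.bind (?H p) (\<lambda>q. Option.bind (G q) (\<lambda>r. ?K (pair p r))) =
      Option.bind (H1 p) (\<lambda>q. Option.bind (Option.bind (H2 q) (\<lambda>q'. Option.bind (G q') (\<lambda>r. K2 (pair q r))))
        (\<lambda>r. K1 (pair p r)))" for p
      by (cases "H1 p"; simp; cases "H2 (the (H1 p))"; simp; cases "G (the (H2 (the (H1 p))))"; simp)
    then show ?thesis using 1(3)[OF 2(3)[OF that]] by presburger
  qed
  ultimately show ?thesis unfolding weihrauch_le_def by blast
qed

section \<open>The two elementary reductions, through marked columns\<close>

lemma computable_Least_column:
  assumes "cpred P" "cfun f"
  shows "computable (\<lambda>q. if \<exists>i. P q i then Some (\<lambda>n. f q (enc (LEAST i. P q i) n)) else None)"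
proof -
  have "cpred (\<lambda>q c. P q (esnd c))" using assms(1) by (rule cpred_comp) (intro cfun_intros)
  then obtain e where e: "\<exists>i. P q i \<Longrightarrow> eval q e [n] (LEAST i. P q i)" for q n
    using eval_Least[of "\<lambda>q c. P q (esnd c)"] by auto
  obtain a where a: "eval q a [k] (f q k)" for q k using assms(2) unfolding cfun_def by blast
  have "recursive 2 (\<lambda>p xs. enc (xs ! 0) (xs ! 1))" by (intro recursive_enc recursive_nth) simp_all
  then obtain d where "\<forall>p xs. length xs = 2 \<longrightarrow> eval p d xs (enc (xs ! 0) (xs ! 1))"
    unfolding recursive_def by blast
  from this[rule_format, of "[x, y]" for x y] have d: "eval p d [x, y] (enc x y)" for p x y by simp
  have "eval q (Comp a [Comp d [e, Proj 0]]) [n] (f q (enc (LEAST i. P q i) n))" if "\<exists>i. P q i" for q n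
  proof (rule eval_Comp1[OF _ a], rule eval_Comp2[OF e[OF that] _ d])
    show "eval q (Proj 0) [n] n" using eval_Proj[of 0 "[n]" q] by simp
  qed
  then show ?thesis unfolding computable_def by (auto split: if_splits)
qed

text \<open>Every marked entry of a weak list of \<open>{x}\<close> equals \<open>x\<close>, and a
  marked entry exists; so the answer is the first one found.\<close>

lemma UC_le_wList: "UC_Baire \<le>\<^sub>W wList"
proof -
  let ?P = "\<lambda>q i. right q (enc i 0) = 1"
  \<comment> \<open>Shifted by one, since position 0 of each column holds the marker.\<close>
  let ?f = "\<lambda>q c. right q (enc (efst c) (Suc (esnd c)))"
  let ?K = "\<lambda>q. if \<exists>i. ?P q i then Some (\<lambda>n. ?f q (enc (LEAST i. ?P q i) n)) else None"
  have "computable (Some :: baire \<rightharpoonup> baire)"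
    using cfun_computable[OF cfun_oracle[OF cfun_id]] by simp
  moreover have "computable ?K" by (rule computable_Least_column) (intro cfun_intros)+
  moreover have "realizes (\<lambda>p. Option.bind (Some p) (\<lambda>q. Option.bind (G q) (\<lambda>r. ?K (pair p r)))) UC_Baire"
    if G: "realizes G wList" for G
    unfolding realizes_def dom_UC_Baire
  proof (intro ballI allI impI)
    fix A p assume A: "A \<in> {{x} |x. True}" "source UC_Baire p = Some A"
    then obtain x where x: "A = {x}" by blast
    have src: "closed_rep p = Some A" using A(2) by (simp add: UC_Baire_def)
    then have "closed A" using ran_closed_rep by (metis mem_Collect_eq ranI)
    then have "A \<in> dom_problem wList" by (simp add: dom_wList x)
    moreover have wList: "source wList = closed_rep" "target wList = baire_seq_rep"
      by (simp_all add: wList_def)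
    ultimately obtain r s where r: "G p = Some r" "baire_seq_rep r = Some s" "s \<in> vals wList A"
      using G src unfolding realizes_def wList by blast
    from r(3) obtain b u where s: "s = (\<lambda>i. b i \<frown> u i)" "A = {u i |i. b i = 1}"
      by (auto simp: wList_def)
    have s_r: "s i n = r (enc i n)" for i n using r(2) by (auto simp: baire_seq_rep_def enc_def)
    have b: "r (enc i 0) = b i" for i using s(1) s_r[of i 0] by simp
    have u: "r (enc i (Suc n)) = u i n" for i n using s(1) s_r[of i "Suc n"] by simp
    obtain j where "b j = 1" using s(2) x by auto
    then have j: "b (LEAST i. b i = 1) = 1" by (rule LeastI)
    then have "u (LEAST i. b i = 1) = x" using s(2) x by auto
    then have "?K (pair p r) = Some x" using \<open>b j = 1\<close> by (auto simp: b u)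
    then show "\<exists>q y. Option.bind (Some p) (\<lambda>q. Option.bind (G q) (\<lambda>r. ?K (pair p r))) = Some q \<and>
        target UC_Baire q = Some y \<and> y \<in> vals UC_Baire A"
      using r(1) x by (simp add: UC_Baire_def baire_rep_def)
  qed
  ultimately show ?thesis unfolding weihrauch_le_def by blast
qed

lemma tuple_enc [simp]: "tuple s (enc i n) = s i n"
  by (simp add: tuple_def enc_def)

text \<open>The leading entry of a list tells which columns are genuine, so the markers are
  computable from it: all columns for 0, otherwise those with index below the size.\<close>

lemma wList_le_List: "wList \<le>\<^sub>W List"
proof -
  let ?F = "\<lambda>q c. if esnd c = 0 then if right q 0 = 0 \<or> efst c < right q 0 - 1 then 1 else 0
    else right q (Suc (enc (efst c) (esnd c - 1)))"
  have "computable (Some :: baire \<rightharpoonup> baire)"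
    using cfun_computable[OF cfun_oracle[OF cfun_id]] by simp
  moreover have "computable (\<lambda>q. Some (?F q))"
    by (rule cfun_computable) (intro cfun_intros)
  moreover have "realizes (\<lambda>p. Option.bind (Some p) (\<lambda>q. Option.bind (G q) (\<lambda>r. Some (?F (pair p r))))) wList"
    if G: "realizes G List" for G
    unfolding realizes_def
  proof (intro ballI allI impI)
    fix A p assume A: "A \<in> dom_problem wList" "source wList p = Some A"
    then have "A \<in> dom_problem List" "source List p = Some A"
      by (simp_all add: dom_wList dom_List) (simp_all add: wList_def List_def)
    moreover have "target List = baire_rep" by (simp add: List_def)
    ultimately obtain r where r: "G p = Some r" "r \<in> vals List A"
      using G unfolding realizes_def baire_rep_def by auto
    from r(2) obtain n u where u: "r = n \<frown> tuple u"
      "n = 0 \<and> A = {u i |i. True} \<or> n > 0 \<and> A = {u i |i. i < n - 1}"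
      unfolding List_def problem.simps mem_Collect_eq by blast
    define b :: "nat \<Rightarrow> nat" where "b i = (if n = 0 \<or> i < n - 1 then 1 else 0)" for i
    have "?F (pair p r) (enc i m) = (b i \<frown> u i) m" for i m
      by (cases m) (simp_all add: u(1) b_def)
    then have "?F (pair p r) (prod_encode (i, m)) = (b i \<frown> u i) m" for i m
      unfolding enc_def[symmetric] by blast
    then have "target wList (?F (pair p r)) = Some (\<lambda>i. b i \<frown> u i)"
      unfolding wList_def problem.simps baire_seq_rep_def by simp
    moreover have "A = {u i |i. b i = 1}" using u(2) by (auto simp: b_def)
    then have "(\<lambda>i. b i \<frown> u i) \<in> vals wList A"
      using A(1) unfolding dom_wList by (auto simp: wList_def)
    ultimately show "\<exists>q y. Option.bind (Some p) (\<lambda>q. Option.bind (G q) (\<lambda>r. Some (?F (pair p r)))) = Some q \<and>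
        target wList q = Some y \<and> y \<in> vals wList A"
      using r(1) by auto
  qed
  ultimately show ?thesis unfolding weihrauch_le_def by blast
qed

section \<open>Functionals reducible to unique choice\<close>

text \<open>
  On \<^term>\<open>D\<close>, the value \<^term>\<open>h p\<close> is computed from \<^term>\<open>p\<close> and the only point of a set that is
  effectively closed relative to \<^term>\<open>p\<close>.
\<close>

definition ufun :: "baire set \<Rightarrow> (baire \<Rightarrow> baire) \<Rightarrow> bool" where
  "ufun D h \<longleftrightarrow> (\<exists>P f. cpred P \<and> cfun f \<and>
    (\<forall>p\<in>D. \<exists>y. (\<forall>z. (\<forall>n. P (pair p z) n) \<longleftrightarrow> z = y) \<and> h p = f (pair p y)))"

definition upred :: "baire set \<Rightarrow> (baire \<Rightarrow> nat \<Rightarrow> bool) \<Rightarrow> bool" where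
  "upred D P \<longleftrightarrow> ufun D (\<lambda>p n. if P p n then 1 else 0)"

text \<open>On \<open>D\<close> the effectively closed set is a singleton, so its computable name is
  a legitimate query, and \<open>f\<close> recovers \<open>h p\<close> from input and
  answer.\<close>

lemma ufun_le_UC:
  assumes "ufun D h"
    and "\<And>x p. x \<in> dom_problem f \<Longrightarrow> source f p = Some x \<Longrightarrow>
      p \<in> D \<and> (\<exists>y. target f (h p) = Some y \<and> y \<in> vals f x)"
  shows "f \<le>\<^sub>W UC_Baire"
proof -
  obtain P g where P: "cpred P" "cfun g"
    "\<And>p. p \<in> D \<Longrightarrow> \<exists>y. (\<forall>z. (\<forall>n. P (pair p z) n) \<longleftrightarrow> z = y) \<and> h p = g (pair p y)"
    using assms(1) unfolding ufun_def by blast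
  obtain H where H: "cfun H" "\<And>p. closed_rep (H p) = Some {y. \<forall>n. P (pair p y) n}"
    using Pi01_closed_name[OF P(1)] by blast
  have "realizes (\<lambda>p. Option.bind (Some (H p)) (\<lambda>q. Option.bind (G q) (\<lambda>r. Some (g (pair p r))))) f"
    if G: "realizes G UC_Baire" for G
    unfolding realizes_def
  proof (intro ballI allI impI)
    fix x p assume x: "x \<in> dom_problem f" "source f p = Some x"
    with P(3) assms(2) obtain y where y: "\<forall>z. (\<forall>n. P (pair p z) n) \<longleftrightarrow> z = y" "h p = g (pair p y)" by blast
    then have "closed_rep (H p) = Some {y}" using H(2) by simp
    moreover have "source UC_Baire = closed_rep" "target UC_Baire = baire_rep"
      "vals UC_Baire A = {x. A = {x}}" for A by (simp_all add: UC_Baire_def)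
    ultimately have "G (H p) = Some y"
      using G unfolding realizes_def dom_UC_Baire baire_rep_def by auto
    then show "\<exists>q y. Option.bind (Some (H p)) (\<lambda>q. Option.bind (G q) (\<lambda>r. Some (g (pair p r)))) = Some q \<and>
        target f q = Some y \<and> y \<in> vals f x"
      using assms(2)[OF x] y(2) by simp
  qed
  then show ?thesis unfolding weihrauch_le_def using cfun_computable[OF H(1)] cfun_computable[OF P(2)] by blast
qed

lemma ufun_cong: "ufun D g \<Longrightarrow> (\<And>p. p \<in> D \<Longrightarrow> h p = g p) \<Longrightarrow> ufun D h"
  unfolding ufun_def by auto

lemma ufun_cfun: assumes "cfun h" shows "ufun D h"
  unfolding ufun_def
proof (intro exI conjI ballI)
  \<comment> \<open>No advice is called for, so the closed set is the singleton of the zero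
    sequence.\<close>
  show "cpred (\<lambda>q n. right q n = 0)" by (intro cfun_intros)
  show "cfun (\<lambda>q. h (left q))"
    by (rule cfun_subst[OF assms]) (intro cfun_intros)+
  fix p
  show "\<forall>z. (\<forall>n. right (pair p z) n = 0) \<longleftrightarrow> z = (\<lambda>_. 0)" by auto
  show "h p = h (left (pair p (\<lambda>_. 0)))" by simp
qed

lemma upred_cpred: "cpred P \<Longrightarrow> upred D P"
  unfolding upred_def cpred_def by (rule ufun_cfun)

text \<open>Two successive queries become one: the point is the pair of both points. The condition
  on the second half can be stated because \<open>f1\<close> computes the intermediate value from
  the first half, and is total even on wrong candidates.\<close>

lemma ufun_comp:
  assumes "ufun UNIV g" "ufun D h"
  shows "ufun D (\<lambda>p. g (pair p (h p)))"
proof -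
  obtain P1 f1 where 1: "cpred P1" "cfun f1"
    "\<And>p. p \<in> D \<Longrightarrow> \<exists>y. (\<forall>z. (\<forall>n. P1 (pair p z) n) \<longleftrightarrow> z = y) \<and> h p = f1 (pair p y)"
    using assms(2) unfolding ufun_def by blast
  obtain P2 f2 where 2: "cpred P2" "cfun f2"
    "\<And>p. \<exists>y. (\<forall>z. (\<forall>n. P2 (pair p z) n) \<longleftrightarrow> z = y) \<and> g p = f2 (pair p y)"
    using assms(1) unfolding ufun_def by blast
  let ?l = "\<lambda>q. pair (left q) (left (right q))"
  let ?r = "\<lambda>q. pair (pair (left q) (f1 (?l q))) (right (right q))"
  have l: "cfun ?l" by (intro cfun_intros)
  have f: "cfun (\<lambda>q. f1 (?l q))" using cfun_subst[OF 1(2) l cfun_id] .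
  have r: "cfun ?r" by (intro cfun_intros f)
  show ?thesis
    unfolding ufun_def
  proof (rule exI, rule exI, intro conjI ballI)
    show "cpred (\<lambda>q n. P1 (?l q) n \<and> P2 (?r q) n)"
      by (intro cfun_intros cpred_subst[OF 1(1) l] cpred_subst[OF 2(1) r])
    show "cfun (\<lambda>q. f2 (?r q))" using cfun_subst[OF 2(2) r cfun_id] .
    fix p assume "p \<in> D"
    then obtain y1 where y1: "\<And>z. (\<forall>n. P1 (pair p z) n) \<longleftrightarrow> z = y1" "h p = f1 (pair p y1)" using 1(3) by blast
    obtain y2 where y2: "\<And>z. (\<forall>n. P2 (pair (pair p (h p)) z) n) \<longleftrightarrow> z = y2" "g (pair p (h p)) = f2 (pair (pair p (h p)) y2)"
      using 2(3) by blast
    have "\<forall>z. (\<forall>n. P1 (?l (pair p z)) n \<and> P2 (?r (pair p z)) n) \<longleftrightarrow> z = pair y1 y2"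
      unfolding eq_pair_iff all_conj_distrib left_pair right_pair
    proof (intro allI)
      fix z
      show "((\<forall>n. P1 (pair p (left z)) n) \<and> (\<forall>n. P2 (pair (pair p (f1 (pair p (left z)))) (right z)) n)) =
          (left z = y1 \<and> right z = y2)"
        unfolding y1(1) using y2(1)[of "right z"] y1(2) by auto
    qed
    moreover have "g (pair p (h p)) = f2 (?r (pair p (pair y1 y2)))" using y1 y2 by simp
    ultimately show "\<exists>y. (\<forall>z. (\<forall>n. P1 (?l (pair p z)) n \<and> P2 (?r (pair p z)) n) \<longleftrightarrow> z = y) \<and>
        g (pair p (h p)) = f2 (?r (pair p y))" by blast
  qed
qed

lemma ufun_app: "cfun F \<Longrightarrow> ufun D h \<Longrightarrow> ufun D (\<lambda>p. F (pair p (h p)))"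
  by (rule ufun_comp[OF ufun_cfun])

lemma ufun_pair:
  assumes "ufun D g" "ufun D h"
  shows "ufun D (\<lambda>p. pair (g p) (h p))"
proof -
  obtain P1 f1 where 1: "cpred P1" "cfun f1"
    "\<And>p. p \<in> D \<Longrightarrow> \<exists>y. (\<forall>z. (\<forall>n. P1 (pair p z) n) \<longleftrightarrow> z = y) \<and> g p = f1 (pair p y)"
    using assms(1) unfolding ufun_def by blast
  obtain P2 f2 where 2: "cpred P2" "cfun f2"
    "\<And>p. p \<in> D \<Longrightarrow> \<exists>y. (\<forall>z. (\<forall>n. P2 (pair p z) n) \<longleftrightarrow> z = y) \<and> h p = f2 (pair p y)"
    using assms(2) unfolding ufun_def by blast
  let ?l = "\<lambda>q. pair (left q) (left (right q))"
  let ?r = "\<lambda>q. pair (left q) (right (right q))"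
  have l: "cfun ?l" and r: "cfun ?r" by (intro cfun_intros)+
  show ?thesis
    unfolding ufun_def
  proof (rule exI, rule exI, intro conjI ballI)
    show "cpred (\<lambda>q n. P1 (?l q) n \<and> P2 (?r q) n)"
      by (intro cfun_intros cpred_subst[OF 1(1) l] cpred_subst[OF 2(1) r])
    show "cfun (\<lambda>q. pair (f1 (?l q)) (f2 (?r q)))"
      by (intro cfun_pair cfun_subst[OF 1(2) l] cfun_subst[OF 2(2) r] cfun_id)
    fix p assume "p \<in> D"
    then obtain y1 y2 where y: "\<And>z. (\<forall>n. P1 (pair p z) n) \<longleftrightarrow> z = y1" "g p = f1 (pair p y1)"
      "\<And>z. (\<forall>n. P2 (pair p z) n) \<longleftrightarrow> z = y2" "h p = f2 (pair p y2)" using 1(3) 2(3) by metis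
    have "\<forall>z. (\<forall>n. P1 (?l (pair p z)) n \<and> P2 (?r (pair p z)) n) \<longleftrightarrow> z = pair y1 y2"
      unfolding eq_pair_iff all_conj_distrib left_pair right_pair y by blast
    moreover have "pair (g p) (h p) = pair (f1 (?l (pair p (pair y1 y2)))) (f2 (?r (pair p (pair y1 y2))))"
      using y by simp
    ultimately show "\<exists>y. (\<forall>z. (\<forall>n. P1 (?l (pair p z)) n \<and> P2 (?r (pair p z)) n) \<longleftrightarrow> z = y) \<and>
        pair (g p) (h p) = pair (f1 (?l (pair p y))) (f2 (?r (pair p y)))" by blast
  qed
qed

text \<open>The unique point is \<open>g p\<close> together with the advice that evaluates
  \<open>C\<close> at it. The condition \<open>C\<close> must be available on \<open>UNIV\<close>,
  because it is evaluated at every candidate \<open>z\<close> and not only at the correct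
  one.\<close>

lemma ufun_implicit:
  assumes "upred UNIV C" "\<And>p z. p \<in> D \<Longrightarrow> (\<forall>n. C (pair p z) n) \<longleftrightarrow> z = g p"
  shows "ufun D g"
proof -
  obtain P f where 1: "cpred P" "cfun f"
    "\<And>p. \<exists>y. (\<forall>z. (\<forall>n. P (pair p z) n) \<longleftrightarrow> z = y) \<and> (\<lambda>n. if C p n then 1 else 0) = f (pair p y)"
    using assms(1) unfolding upred_def ufun_def by blast
  let ?r = "\<lambda>q. pair (pair (left q) (left (right q))) (right (right q))"
  have r: "cfun ?r" by (intro cfun_intros)
  show ?thesis
    unfolding ufun_def
  proof (rule exI, rule exI, intro conjI ballI)
    show "cpred (\<lambda>q n. P (?r q) n \<and> f (?r q) n = 1)"
      by (intro cfun_intros cpred_subst[OF 1(1) r] cfun_subst[OF 1(2) r])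
    show "cfun (\<lambda>q. left (right q))" by (intro cfun_intros)
    fix p assume p: "p \<in> D"
    \<comment> \<open>\<open>W q\<close> is the unique advice for evaluating \<open>C\<close> at
      \<open>q\<close>; it exists for every \<open>q\<close>.\<close>
    obtain W where W: "\<And>q z. (\<forall>n. P (pair q z) n) \<longleftrightarrow> z = W q"
      "\<And>q. (\<lambda>n. if C q n then 1 else 0) = f (pair q (W q))"
      using 1(3) by metis
    have f: "f (pair q (W q)) n = 1 \<longleftrightarrow> C q n" for q n
      using fun_cong[OF W(2)[of q], of n] by (cases "C q n") simp_all
    have "\<forall>z. (\<forall>n. P (?r (pair p z)) n \<and> f (?r (pair p z)) n = 1) \<longleftrightarrow> z = pair (g p) (W (pair p (g p)))"
    proof (intro allI)
      fix z
      have "(\<forall>n. P (?r (pair p z)) n) \<longleftrightarrow> right z = W (pair p (left z))"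
        unfolding left_pair right_pair W(1) ..
      moreover have "(\<forall>n. f (pair (pair p (left z)) (W (pair p (left z)))) n = 1) \<longleftrightarrow> left z = g p"
        unfolding f by (rule assms(2)[OF p])
      ultimately show "(\<forall>n. P (?r (pair p z)) n \<and> f (?r (pair p z)) n = 1) = (z = pair (g p) (W (pair p (g p))))"
        unfolding eq_pair_iff all_conj_distrib left_pair right_pair by metis
    qed
    moreover have "g p = left (right (pair p (pair (g p) (W (pair p (g p))))))" by simp
    ultimately show "\<exists>y. (\<forall>z. (\<forall>n. P (?r (pair p z)) n \<and> f (?r (pair p z)) n = 1) \<longleftrightarrow> z = y) \<and>
        g p = left (right (pair p y))" by blast
  qed
qed

text \<open>Eliminates one unbounded number quantifier. A wrong 0 in the table is refuted by a
  single witness, a wrong successor by finitely many checks, so the correct tables form an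
  effectively closed set. Demanding the least witness leaves only one of them.\<close>

lemma ufun_search:
  assumes "cpred Q"
  shows "ufun D (\<lambda>p n. if \<exists>k. Q p (enc n k) then Suc (LEAST k. Q p (enc n k)) else 0)" (is "ufun D ?g")
proof (rule ufun_implicit)
  let ?C = "\<lambda>q n. (right q (efst n) = 0 \<longrightarrow> \<not> Q (left q) (enc (efst n) (esnd n))) \<and>
    (right q (efst n) \<noteq> 0 \<longrightarrow> Q (left q) (enc (efst n) (right q (efst n) - 1)) \<and>
      (\<forall>k<right q (efst n) - 1. \<not> Q (left q) (enc (efst n) k)))"
  have Q: "cfun i \<Longrightarrow> cpred (\<lambda>q n. Q (left q) (i q n))" for i
    by (rule cpred_subst[OF assms]) (intro cfun_intros)
  have "cpred ?C" by (intro cfun_intros Q)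
  then show "upred UNIV ?C" by (rule upred_cpred)
  fix p z
  have A: "z a = ?g p a" if z: "\<forall>n. ?C (pair p z) n" for a
  proof (cases "z a")
    case 0
    then have "\<not> Q p (enc a k)" for k using z[rule_format, of "enc a k"] by simp
    then show ?thesis using 0 by simp
  next
    case (Suc m)
    then have m: "Q p (enc a m)" "\<And>k. k < m \<Longrightarrow> \<not> Q p (enc a k)"
      using z[rule_format, of "enc a 0"] by auto
    then have "(LEAST k. Q p (enc a k)) = m" by (intro Least_equality) (auto simp: not_less[symmetric])
    then show ?thesis using Suc m(1) by auto
  qed
  have B: "?C (pair p (?g p)) n" for n
  proof (cases "\<exists>k. Q p (enc (efst n) k)")
    case True
    define m where "m = (LEAST k. Q p (enc (efst n) k))"
    have g: "?g p (efst n) = Suc m" using True by (simp only: m_def if_True)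
    have "Q p (enc (efst n) m)" "\<And>k. k < m \<Longrightarrow> \<not> Q p (enc (efst n) k)"
      unfolding m_def by (rule LeastI_ex[OF True], rule not_less_Least)
    then show ?thesis unfolding left_pair right_pair g by simp
  next
    case False
    then show ?thesis by (simp del: enc_efst_esnd)
  qed
  show "(\<forall>n. ?C (pair p z) n) \<longleftrightarrow> z = ?g p"
  proof
    assume "\<forall>n. ?C (pair p z) n"
    then show "z = ?g p" by (intro ext A)
  next
    assume z: "z = ?g p"
    show "\<forall>n. ?C (pair p z) n" unfolding z by (intro allI B)
  qed
qed

section \<open>Closure under arithmetical definitions\<close>

lemma ufun_lift2:
  assumes "cfun F" "ufun D f" "ufun D g" "\<And>p n. H p n = F (pair (f p) (g p)) n"
  shows "ufun D H"
proof -
  have "cfun (\<lambda>q. F (right q))"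
    using cfun_subst[OF assms(1) _ cfun_id, of right] cfun_right[OF cfun_oracle[OF cfun_id] cfun_id] by simp
  from ufun_app[OF this ufun_pair[OF assms(2,3)]] show ?thesis
    by (rule ufun_cong) (auto simp: assms(4))
qed

named_theorems ufun_intros

lemma ufun_apply:
  assumes "ufun D f" "ufun D g"
  shows "ufun D (\<lambda>p n. f p (g p n))"
  by (rule ufun_lift2[where F = "\<lambda>q n. left q (right q n)", OF _ assms]) (intro cfun_intros, simp)

lemma upred_apply:
  assumes "upred D P" "ufun D g"
  shows "upred D (\<lambda>p n. P p (g p n))"
  using ufun_apply[OF assms(1)[unfolded upred_def] assms(2)] unfolding upred_def .

lemma ufun_id [ufun_intros]: "ufun D (\<lambda>p n. n)"
  by (rule ufun_cfun) (rule cfun_id)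

lemma ufun_const [ufun_intros]: "ufun D (\<lambda>p n. c)"
  by (rule ufun_cfun) (rule cfun_const)

lemma ufun_enc [ufun_intros]: "ufun D f \<Longrightarrow> ufun D g \<Longrightarrow> ufun D (\<lambda>p n. enc (f p n) (g p n))"
  by (rule ufun_lift2[where F = "\<lambda>q n. enc (left q n) (right q n)"]) (intro cfun_intros, assumption+, simp)

lemma ufun_diff [ufun_intros]: "ufun D f \<Longrightarrow> ufun D g \<Longrightarrow> ufun D (\<lambda>p n. f p n - g p n)"
  by (rule ufun_lift2[where F = "\<lambda>q n. left q n - right q n"]) (intro cfun_intros, assumption+, simp)

lemma ufun_cfun_apply: "cfun F \<Longrightarrow> ufun D f \<Longrightarrow> ufun D (\<lambda>p n. F p (f p n))"
  by (rule ufun_apply[OF ufun_cfun])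

lemma ufun_Suc [ufun_intros]: "ufun D f \<Longrightarrow> ufun D (\<lambda>p n. Suc (f p n))"
  by (rule ufun_cfun_apply[of "\<lambda>p n. Suc n"]) (intro cfun_intros)

lemma ufun_efst [ufun_intros]: "ufun D f \<Longrightarrow> ufun D (\<lambda>p n. efst (f p n))"
  by (rule ufun_cfun_apply[of "\<lambda>p n. efst n"]) (intro cfun_intros)

lemma ufun_esnd [ufun_intros]: "ufun D f \<Longrightarrow> ufun D (\<lambda>p n. esnd (f p n))"
  by (rule ufun_cfun_apply[of "\<lambda>p n. esnd n"]) (intro cfun_intros)

lemma ufun_length [ufun_intros]: "ufun D f \<Longrightarrow> ufun D (\<lambda>p n. length (list_decode (f p n)))"
  by (rule ufun_cfun_apply[of "\<lambda>p n. length (list_decode n)"]) (intro cfun_intros)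

lemma ufun_nth_code [ufun_intros]: "ufun D f \<Longrightarrow> ufun D g \<Longrightarrow> ufun D (\<lambda>p n. nth_code (f p n) (g p n))"
  by (rule ufun_lift2[where F = "\<lambda>q n. nth_code (left q n) (right q n)"]) (intro cfun_intros, assumption+, simp)

lemma upred_lift2:
  assumes "cpred F" "ufun D f" "ufun D g" "\<And>p n. H p n \<longleftrightarrow> F (pair (f p) (g p)) n"
  shows "upred D H"
  unfolding upred_def by (rule ufun_lift2[OF assms(1)[unfolded cpred_def] assms(2,3)]) (simp add: assms(4))

lemma upred_not [ufun_intros]: "upred D P \<Longrightarrow> upred D (\<lambda>p n. \<not> P p n)"
  by (rule upred_lift2[where F = "\<lambda>q n. left q n = 0"]) (intro cfun_intros, unfold upred_def, assumption+, simp)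

lemma upred_conj [ufun_intros]: "upred D P \<Longrightarrow> upred D Q \<Longrightarrow> upred D (\<lambda>p n. P p n \<and> Q p n)"
  by (rule upred_lift2[where F = "\<lambda>q n. left q n = 1 \<and> right q n = 1"])
    (intro cfun_intros, unfold upred_def, assumption+, simp)

lemma upred_disj [ufun_intros]: "upred D P \<Longrightarrow> upred D Q \<Longrightarrow> upred D (\<lambda>p n. P p n \<or> Q p n)"
  by (rule upred_lift2[where F = "\<lambda>q n. left q n = 1 \<or> right q n = 1"])
    (intro cfun_intros, unfold upred_def, assumption+, simp)

lemma upred_imp [ufun_intros]: "upred D P \<Longrightarrow> upred D Q \<Longrightarrow> upred D (\<lambda>p n. P p n \<longrightarrow> Q p n)"
  unfolding imp_conv_disj by (intro ufun_intros)

lemma upred_eq [ufun_intros]: "ufun D f \<Longrightarrow> ufun D g \<Longrightarrow> upred D (\<lambda>p n. f p n = g p n)"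
  by (rule upred_lift2[where F = "\<lambda>q n. left q n = right q n"]) (intro cfun_intros, assumption+, simp)

lemma upred_less [ufun_intros]: "ufun D f \<Longrightarrow> ufun D g \<Longrightarrow> upred D (\<lambda>p n. f p n < g p n)"
  by (rule upred_lift2[where F = "\<lambda>q n. left q n < right q n"]) (intro cfun_intros, assumption+, simp)

lemma ufun_if [ufun_intros]:
  assumes "upred D P" "ufun D f" "ufun D g"
  shows "ufun D (\<lambda>p n. if P p n then f p n else g p n)"
  by (rule ufun_lift2[where F = "\<lambda>q n. if left q n = 1 then left (right q) n else right (right q) n",
        OF _ assms(1)[unfolded upred_def] ufun_pair[OF assms(2,3)]])
    (intro cfun_intros, simp)

lemma ufun_case_nat [ufun_intros]:
  assumes "ufun D a" "ufun D (\<lambda>p c. g p (efst c) (esnd c))" "ufun D b"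
  shows "ufun D (\<lambda>p n. case_nat (a p n) (g p n) (b p n))"
proof -
  have "ufun D (\<lambda>p n. if b p n = 0 then a p n else g p (efst (enc n (b p n - 1))) (esnd (enc n (b p n - 1))))"
    by (intro ufun_intros assms ufun_apply[OF assms(2)])
  moreover have "(if m = 0 then x else g p n (m - 1)) = case_nat x (g p n) m" for m x p n
    by (cases m) auto
  ultimately show ?thesis unfolding efst_enc esnd_enc by (simp only:)
qed

lemma ufun_sum [ufun_intros]:
  assumes "ufun D (\<lambda>p c. f p (efst c) (esnd c))" "ufun D b"
  shows "ufun D (\<lambda>p n. \<Sum>k<b p n. f p n k)"
  by (rule ufun_lift2[where F = "\<lambda>q n. \<Sum>k<right q n. left q (enc n k)", OF _ assms]) (intro cfun_intros, simp)

text \<open>The search is relative to the characteristic function of a predicate that may itself be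
  non-computable. Iterating this step handles any number of quantifier alternations.\<close>

lemma ufun_ex_Least:
  assumes "upred D (\<lambda>p c. P p (efst c) (esnd c))"
  shows "ufun D (\<lambda>p n. if \<exists>k. P p n k then Suc (LEAST k. P p n k) else 0)"
proof -
  have "cpred (\<lambda>q c. right q c = 1)" by (intro cfun_intros)
  from ufun_comp[OF ufun_search[OF this] assms[unfolded upred_def]] show ?thesis
    by (rule ufun_cong) (simp add: fun_eq_iff if_distrib cong: if_cong)
qed

lemma upred_ex [ufun_intros]:
  assumes "upred D (\<lambda>p c. P p (efst c) (esnd c))"
  shows "upred D (\<lambda>p n. \<exists>k. P p n k)"
proof -
  have "upred D (\<lambda>p n. (if \<exists>k. P p n k then Suc (LEAST k. P p n k) else 0) \<noteq> 0)"
    by (intro ufun_intros ufun_ex_Least assms)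
  then show ?thesis unfolding upred_def by (rule ufun_cong) (auto simp: fun_eq_iff)
qed

lemma upred_all [ufun_intros]:
  assumes "upred D (\<lambda>p c. P p (efst c) (esnd c))"
  shows "upred D (\<lambda>p n. \<forall>k. P p n k)"
proof -
  have "upred D (\<lambda>p n. \<not> (\<exists>k. \<not> P p n k))" by (intro ufun_intros assms)
  then show ?thesis by simp
qed

lemma ufun_Least:
  assumes "upred D (\<lambda>p c. P p (efst c) (esnd c))"
  shows "ufun D (\<lambda>p n. if \<exists>k. P p n k then LEAST k. P p n k else 0)"
proof -
  have "ufun D (\<lambda>p n. (if \<exists>k. P p n k then Suc (LEAST k. P p n k) else 0) - 1)"
    by (intro ufun_intros ufun_ex_Least assms)
  then show ?thesis by (rule ufun_cong) (auto simp: fun_eq_iff)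
qed

section \<open>Stage comparison for monotone operators\<close>

text \<open>The transfinite iterates of \<open>\<Gamma>\<close>, obtained without ordinals: the
  union of the empty family is the bottom stage, and other unions supply the limits.\<close>

inductive_set stages :: "('a set \<Rightarrow> 'a set) \<Rightarrow> 'a set set" for \<Gamma> where
  step: "X \<in> stages \<Gamma> \<Longrightarrow> \<Gamma> X \<in> stages \<Gamma>"
| Union: "\<forall>X\<in>\<C>. X \<in> stages \<Gamma> \<Longrightarrow> \<Union>\<C> \<in> stages \<Gamma>"

text \<open>Since stages are closed under unions, this is the largest stage missing
  \<open>b\<close>; when everything is eventually reached, \<open>b\<close> enters at the very next
  one.\<close>

definition stage_before :: "('a set \<Rightarrow> 'a set) \<Rightarrow> 'a \<Rightarrow> 'a set" where
  "stage_before \<Gamma> b = \<Union>{X \<in> stages \<Gamma>. b \<notin> X}"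

definition stage_le :: "('a set \<Rightarrow> 'a set) \<Rightarrow> 'a \<Rightarrow> 'a \<Rightarrow> bool" where
  "stage_le \<Gamma> a b \<longleftrightarrow> a \<in> \<Gamma> (stage_before \<Gamma> b)"

lemma stage_before_stage: "stage_before \<Gamma> b \<in> stages \<Gamma>"
  unfolding stage_before_def by (rule stages.Union) simp

lemma not_in_stage_before: "b \<notin> stage_before \<Gamma> b"
  by (simp add: stage_before_def)

lemma subset_stage_before: "X \<in> stages \<Gamma> \<Longrightarrow> b \<notin> X \<Longrightarrow> X \<subseteq> stage_before \<Gamma> b"
  by (auto simp: stage_before_def)

context
  fixes \<Gamma> :: "'a set \<Rightarrow> 'a set"
  assumes mono: "mono \<Gamma>"
begin

lemma stages_subset: "X \<in> stages \<Gamma> \<Longrightarrow> X \<subseteq> \<Gamma> X"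
proof (induction rule: stages.induct)
  case (step X)
  then show ?case using mono by (auto dest: monoD)
next
  case (Union \<C>)
  show ?case
  proof (rule Union_least)
    fix X assume "X \<in> \<C>"
    then show "X \<subseteq> \<Gamma> (\<Union>\<C>)" using Union monoD[OF mono, of X "\<Union>\<C>"] by blast
  qed
qed

text \<open>The nested induction of the Bourbaki-Witt argument. The second alternative has a gap of
  one application of \<open>\<Gamma>\<close>, stronger than plain comparability, and it is this form
  that the step case uses.\<close>

lemma stages_linear:
  assumes "X \<in> stages \<Gamma>" "Y \<in> stages \<Gamma>"
  shows "X \<subseteq> Y \<or> \<Gamma> Y \<subseteq> X"
  using assms
proof (induction arbitrary: Y rule: stages.induct)
  case (step X)
  from step.prems have "\<Gamma> X \<subseteq> Y \<or> Y \<subseteq> X"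
  proof (induction rule: stages.induct)
    case (step Y)
    have "Y \<subseteq> \<Gamma> Y" using step.hyps by (rule stages_subset)
    then show ?case using step.IH \<open>\<And>Y. Y \<in> stages \<Gamma> \<Longrightarrow> X \<subseteq> Y \<or> \<Gamma> Y \<subseteq> X\<close>[OF step.hyps]
      by (metis order.trans order.antisym order.refl)
  next
    case (Union \<C>)
    then show ?case by blast
  qed
  then show ?case using monoD[OF mono] by blast
next
  case (Union \<C>)
  then show ?case by blast
qed

context
  assumes lfp: "lfp \<Gamma> = UNIV"
begin

text \<open>Otherwise the largest stage missing \<open>b\<close> would be a prefixed point of
  \<open>\<Gamma>\<close> and would contain everything.\<close>

lemma in_next_stage: "b \<in> \<Gamma> (stage_before \<Gamma> b)"
proof (rule ccontr)
  assume "b \<notin> \<Gamma> (stage_before \<Gamma> b)"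
  then have "\<Gamma> (stage_before \<Gamma> b) \<subseteq> stage_before \<Gamma> b"
    by (intro subset_stage_before stages.step stage_before_stage)
  then have "lfp \<Gamma> \<subseteq> stage_before \<Gamma> b" by (rule lfp_lowerbound)
  then show False using lfp not_in_stage_before[of b \<Gamma>] by blast
qed

text \<open>This closes the recursion: the stage before \<open>b\<close> is recovered from the
  comparison itself, as the set of \<open>c\<close> with
  \<open>\<not> stage_le \<Gamma> b c\<close>.\<close>

lemma not_stage_le_iff: "\<not> stage_le \<Gamma> b c \<longleftrightarrow> c \<in> stage_before \<Gamma> b"
proof
  assume "\<not> stage_le \<Gamma> b c"
  then have "\<not> stage_before \<Gamma> b \<subseteq> stage_before \<Gamma> c"
    using in_next_stage[of b] monoD[OF mono] unfolding stage_le_def by blast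
  then show "c \<in> stage_before \<Gamma> b" using subset_stage_before stage_before_stage by metis
next
  assume c: "c \<in> stage_before \<Gamma> b"
  then have "\<not> stage_before \<Gamma> b \<subseteq> stage_before \<Gamma> c" using not_in_stage_before by fast
  then have "\<Gamma> (stage_before \<Gamma> c) \<subseteq> stage_before \<Gamma> b"
    using stages_linear[OF stage_before_stage stage_before_stage] by blast
  then show "\<not> stage_le \<Gamma> b c" unfolding stage_le_def using not_in_stage_before by fast
qed

text \<open>
  The stage comparison is the only relation satisfying its recursive characterisation, although
  no well-foundedness is demanded of \<^term>\<open>Y\<close>: every stage is downward closed under \<^term>\<open>Y\<close>.
\<close>

lemma stage_le_unique:
  "(\<forall>a b. Y a b \<longleftrightarrow> a \<in> \<Gamma> {c. \<not> Y b c}) \<longleftrightarrow> Y = stage_le \<Gamma>"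
proof
  assume Y: "\<forall>a b. Y a b \<longleftrightarrow> a \<in> \<Gamma> {c. \<not> Y b c}"
  \<comment> \<open>If \<open>X\<close> is downward closed and \<open>c\<close> lies outside, then
    everything in \<open>X\<close> is strictly below \<open>c\<close> in the sense of
    \<open>Y\<close>; monotonicity of \<open>\<Gamma>\<close> does the rest.\<close>
  have below: "Y a c" if "\<forall>a\<in>X. \<forall>b. Y b a \<longrightarrow> b \<in> X" "c \<notin> X" "a \<in> \<Gamma> X" for X a c
  proof -
    have "X \<subseteq> {d. \<not> Y c d}" using that(1,2) by blast
    then have "a \<in> \<Gamma> {d. \<not> Y c d}" using monoD[OF mono] that(3) by blast
    then show ?thesis using Y by blast
  qed
  have down: "X \<in> stages \<Gamma> \<Longrightarrow> \<forall>a\<in>X. \<forall>b. Y b a \<longrightarrow> b \<in> X" for X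
  proof (induction rule: stages.induct)
    case (step X)
    show ?case
    proof (intro ballI allI impI)
      fix a b assume a: "a \<in> \<Gamma> X" and ba: "Y b a"
      show "b \<in> \<Gamma> X"
      proof (cases "a \<in> X")
        case True
        then show ?thesis using step.IH ba stages_subset[OF step.hyps] by blast
      next
        case False
        \<comment> \<open>For \<open>a\<close> entering right after \<open>X\<close> the recursion
          evaluates at exactly \<open>X\<close>: points outside are above \<open>a\<close> by
          \<open>below\<close>, and a point of \<open>X\<close> above \<open>a\<close> would pull
          \<open>a\<close> into \<open>X\<close>.\<close>
        have "\<not> Y a c \<longleftrightarrow> c \<in> X" for c
          using below[OF step.IH _ a] step.IH False by blast
        then have "{c. \<not> Y a c} = X" by blast
        then show ?thesis using Y ba by metis
      qed
    qed
  next
    case (Union \<C>)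
    then show ?case by blast
  qed
  have "\<not> Y b c \<longleftrightarrow> c \<in> stage_before \<Gamma> b" for b c
    using below[OF down[OF stage_before_stage] _ in_next_stage] down[OF stage_before_stage[of \<Gamma> b]]
      not_in_stage_before[of b \<Gamma>] by blast
  then have eq: "{c. \<not> Y b c} = stage_before \<Gamma> b" for b by blast
  have "Y a b = stage_le \<Gamma> a b" for a b
    by (subst Y[rule_format]) (simp only: eq stage_le_def)
  then show "Y = stage_le \<Gamma>" by (intro ext)
next
  assume Y: "Y = stage_le \<Gamma>"
  show "\<forall>a b. Y a b \<longleftrightarrow> a \<in> \<Gamma> {c. \<not> Y b c}"
    unfolding Y not_stage_le_iff by (simp add: stage_le_def)
qed

text \<open>Well-foundedness in a form free of ordinals: take an element of \<open>Z\<close> that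
  enters right after the largest stage disjoint from \<open>Z\<close>.\<close>

lemma stage_le_minimal:
  assumes "z \<in> Z"
  shows "\<exists>a\<in>Z. \<forall>b\<in>Z. stage_le \<Gamma> a b"
proof -
  define B where "B = \<Union>{X \<in> stages \<Gamma>. X \<inter> Z = {}}"
  have B: "B \<in> stages \<Gamma>" unfolding B_def by (rule stages.Union) simp
  have BZ: "B \<inter> Z = {}" unfolding B_def by blast
  have "\<Gamma> B \<inter> Z \<noteq> {}"
  proof
    assume "\<Gamma> B \<inter> Z = {}"
    then have "\<Gamma> B \<subseteq> B" using stages.step[OF B] unfolding B_def by blast
    then have "lfp \<Gamma> \<subseteq> B" by (rule lfp_lowerbound)
    then show False using lfp BZ assms by blast
  qed
  then obtain a where a: "a \<in> \<Gamma> B" "a \<in> Z" by blast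
  have "stage_le \<Gamma> a b" if "b \<in> Z" for b
  proof -
    have "B \<subseteq> stage_before \<Gamma> b" using BZ that by (intro subset_stage_before B) blast
    then show ?thesis unfolding stage_le_def using monoD[OF mono] a(1) by blast
  qed
  then show ?thesis using a(2) by blast
qed

end

end

section \<open>Trees with countably many paths\<close>

text \<open>Defined for all sequences, not only nodes: outside a tree there are no extensions in it
  and the condition is vacuous, so the least fixed point can be all of \<open>UNIV\<close>.\<close>

definition thin :: "nat list set \<Rightarrow> nat list set \<Rightarrow> nat list set" where
  "thin T X = {u. \<forall>v w. v \<in> T \<and> w \<in> T \<and> prefix u v \<and> prefix u w \<and>
    \<not> prefix v w \<and> \<not> prefix w v \<longrightarrow> v \<in> X \<or> w \<in> X}"

lemma mono_thin: "mono (thin T)"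
  by (rule monoI) (unfold thin_def, blast)

lemma prefix_map_upt: "m \<le> n \<Longrightarrow> prefix (map x [0..<m]) (map x [0..<n])"
  by (metis le_iff_add map_append prefixI upt_add_eq_append zero_le)

lemma prefix_of_map_upt: "(\<And>i. i < length u \<Longrightarrow> u ! i = x i) \<Longrightarrow> u = map x [0..<length u]"
  by (rule nth_equalityI) simp_all

lemma prefix_nth: "prefix u v \<Longrightarrow> i < length u \<Longrightarrow> v ! i = u ! i"
  by (auto simp: prefix_def nth_append)

lemma uncountable_nat_sets: "\<not> countable (UNIV :: nat set set)"
proof
  assume "countable (UNIV :: nat set set)"
  then have "range (from_nat_into (UNIV :: nat set set)) = Pow UNIV" by simp
  then show False using Cantors_theorem by blast
qed

lemma lfp_thin:
  assumes tree: "is_tree T" and countable: "countable (paths T)"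
  shows "lfp (thin T) = UNIV"
proof (rule ccontr)
  let ?L = "lfp (thin T)"
  assume "?L \<noteq> UNIV"
  then obtain u0 where u0: "u0 \<notin> ?L" by blast
  have "\<exists>v w. v \<in> T - ?L \<and> w \<in> T - ?L \<and> prefix u v \<and> prefix u w \<and> \<not> prefix v w \<and> \<not> prefix w v"
    if "u \<notin> ?L" for u
  proof -
    have "u \<notin> thin T ?L" using that by (subst lfp_unfold[OF mono_thin, symmetric])
    then show ?thesis unfolding thin_def[of T ?L] by blast
  qed
  then obtain f g where fg: "\<And>u. u \<notin> ?L \<Longrightarrow> f u \<in> T - ?L \<and> g u \<in> T - ?L \<and> prefix u (f u) \<and>
      prefix u (g u) \<and> \<not> prefix (f u) (g u) \<and> \<not> prefix (g u) (f u)" by metis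
  \<comment> \<open>A set \<open>s\<close> of natural numbers serves as the sequence of choices
    between the two incompatible extensions given by \<open>f\<close> and \<open>g\<close>.\<close>
  define node where "node s = rec_nat u0 (\<lambda>n u. if n \<in> s then f u else g u)" for s :: "nat set"
  have node_0: "node s 0 = u0"
    and node_Suc: "node s (Suc n) = (if n \<in> s then f (node s n) else g (node s n))" for s n
    by (simp_all add: node_def)
  have node_L: "node s n \<notin> ?L" for s n
    by (induction n) (use u0 fg in \<open>auto simp: node_0 node_Suc\<close>)
  have node_T: "node s (Suc n) \<in> T" for s n
    using fg[OF node_L] by (simp add: node_Suc)
  have node_strict: "strict_prefix (node s n) (node s (Suc n))" for s n
    using fg[OF node_L, of s n] by (auto simp: node_Suc strict_prefix_def)
  have node_len: "n \<le> length (node s n)" for s n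
  proof (induction n)
    case (Suc n)
    then show ?case using prefix_length_less[OF node_strict, of s n] by simp
  qed simp
  have node_mono: "prefix (node s m) (node s n)" if "m \<le> n" for s m n
    using that
  proof (induction rule: dec_induct)
    case (step n)
    then show ?case using node_strict[of s n] by (auto simp: strict_prefix_def intro: prefix_order.trans)
  qed simp
  \<comment> \<open>Read off at level \<open>Suc i\<close>, where the node is already longer than
    \<open>i\<close>.\<close>
  define x where "x s i = node s (Suc i) ! i" for s i
  have node_eq: "node s m = map (x s) [0..<length (node s m)]" for s m
  proof (rule prefix_of_map_upt)
    fix i assume i: "i < length (node s m)"
    have i': "i < length (node s (Suc i))" using node_len[of "Suc i" s] by simp
    show "node s m ! i = x s i"
      unfolding x_def using prefix_nth[OF node_mono, of m "Suc i" i s] prefix_nth[OF node_mono, of "Suc i" m i s] i i'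
      by (cases "m \<le> Suc i") auto
  qed
  have "x s \<in> paths T" for s
    unfolding paths_def
  proof (intro CollectI allI)
    fix n
    have "prefix (map (x s) [0..<n]) (map (x s) [0..<length (node s (Suc n))])"
      using node_len[of "Suc n" s] by (intro prefix_map_upt) simp
    then have "prefix (map (x s) [0..<n]) (node s (Suc n))" by (simp flip: node_eq)
    then show "map (x s) [0..<n] \<in> T"
      using node_T[of s n] tree unfolding is_tree_def prefix_def by metis
  qed
  moreover have "inj x"
  proof (rule injI, rule ccontr)
    fix s t assume xs: "x s = x t" and "s \<noteq> t"
    then obtain n0 where n0: "(n0 \<in> s) \<noteq> (n0 \<in> t)" by blast
    define n where "n = (LEAST n. (n \<in> s) \<noteq> (n \<in> t))"
    have n: "(n \<in> s) \<noteq> (n \<in> t)" unfolding n_def using n0 by (rule LeastI)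
    have "node s k = node t k" if "k \<le> n" for k
      using that
    proof (induction k)
      case (Suc k)
      then have "(k \<in> s) = (k \<in> t)" using not_less_Least[of k "\<lambda>n. (n \<in> s) \<noteq> (n \<in> t)"] by (auto simp: n_def)
      with Suc show ?case by (simp add: node_Suc)
    qed (simp add: node_0)
    then have "node s n = node t n" by simp
    then have "\<not> prefix (node s (Suc n)) (node t (Suc n)) \<and> \<not> prefix (node t (Suc n)) (node s (Suc n))"
      using n fg[OF node_L, of t n] by (auto simp: node_Suc)
    moreover have "prefix (node s (Suc n)) (node t (Suc n)) \<or> prefix (node t (Suc n)) (node s (Suc n))"
      using node_eq[of s "Suc n"] node_eq[of t "Suc n"] xs prefix_map_upt by (metis linear)
    ultimately show False by blast
  qed
  ultimately have "countable (UNIV :: nat set set)"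
    using countable by (metis countable_image_inj_eq countable_subset image_subsetI)
  then show False using uncountable_nat_sets by blast
qed

section \<open>Enumerating sets of natural numbers\<close>

text \<open>The default 0 makes this total, so the \<open>ufun\<close> rules apply without an
  existence proof.\<close>

definition least0 :: "(nat \<Rightarrow> bool) \<Rightarrow> nat" where
  "least0 P = (if \<exists>k. P k then LEAST k. P k else 0)"

lemma least0I: "P k \<Longrightarrow> P (least0 P)"
  unfolding least0_def by (auto intro: LeastI)

text \<open>The number of elements of \<open>S\<close> below \<open>a\<close>, as a bounded sum
  because that form is covered by the closure rules.\<close>

definition rank :: "nat set \<Rightarrow> nat \<Rightarrow> nat" where
  "rank S a = (\<Sum>b<a. if b \<in> S then 1 else 0)"

lemma rank_mono: "a \<le> b \<Longrightarrow> rank S a \<le> rank S b"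
  unfolding rank_def by (rule sum_mono2) auto

lemma rank_Suc: "a \<in> S \<Longrightarrow> rank S (Suc a) = Suc (rank S a)"
  by (simp add: rank_def)

lemma rank_inj_on: "inj_on (rank S) S"
proof (rule linorder_inj_onI)
  fix a b assume "a < b" "a \<in> S"
  then have "Suc (rank S a) \<le> rank S b" using rank_mono[of "Suc a" b S] by (simp add: rank_Suc)
  then show "rank S a \<noteq> rank S b" by simp
qed auto

lemma rank_bounded: 
  assumes "\<And>a. a \<in> S \<Longrightarrow> a < m" shows "rank S m = card S"
proof -
  have "rank S m = card ({..<m} \<inter> S)" by (simp add: rank_def sum.If_cases)
  also have "{..<m} \<inter> S = S" using assms by blast
  finally show ?thesis .
qed

text \<open>The rank starts at 0 and climbs in steps of at most one, only at elements of
  \<open>S\<close>, so no value is skipped.\<close>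

lemma rank_attained: "i < rank S n \<Longrightarrow> \<exists>a\<in>S. rank S a = i"
proof (induction n)
  case (Suc n)
  then show ?case by (cases "n \<in> S") (auto simp: rank_def less_Suc_eq)
qed (simp add: rank_def)

lemma rank_unbounded:
  assumes "infinite S" shows "\<exists>n. i < rank S n"
proof (induction i)
  case 0
  obtain a where "a \<in> S" using assms by fastforce
  then show ?case by (metis rank_Suc zero_less_Suc)
next
  case (Suc i)
  then obtain n where n: "i < rank S n" by blast
  obtain a where "a > n" "a \<in> S" using assms infinite_nat_iff_unbounded by blast
  then have "Suc i < rank S (Suc a)" using n rank_mono[of n a S] by (simp add: rank_Suc)
  then show ?case by blast
qed

definition nth_elem :: "nat set \<Rightarrow> nat \<Rightarrow> nat" where
  "nth_elem S i = least0 (\<lambda>a. a \<in> S \<and> rank S a = i)"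

lemma nth_elem:
  assumes "infinite S \<or> i < card S"
  shows "nth_elem S i \<in> S" "rank S (nth_elem S i) = i"
proof -
  have "\<exists>n. i < rank S n"
  proof (cases "finite S")
    case True
    then obtain m where "\<And>a. a \<in> S \<Longrightarrow> a < m" using finite_nat_set_iff_bounded by auto
    then have "i < rank S m" using rank_bounded[of S m] assms True by simp
    then show ?thesis ..
  next
    case False
    then show ?thesis by (rule rank_unbounded)
  qed
  then obtain a where "a \<in> S \<and> rank S a = i" using rank_attained by blast
  then have "nth_elem S i \<in> S \<and> rank S (nth_elem S i) = i" unfolding nth_elem_def by (rule least0I)
  then show "nth_elem S i \<in> S" "rank S (nth_elem S i) = i" by blast+
qed

lemma rank_less_card: "finite S \<Longrightarrow> a \<in> S \<Longrightarrow> rank S a < card S"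
proof -
  assume "finite S" "a \<in> S"
  then obtain m where m: "\<And>a. a \<in> S \<Longrightarrow> a < m" using finite_nat_set_iff_bounded by auto
  then have "rank S (Suc a) \<le> rank S m" using \<open>a \<in> S\<close> by (intro rank_mono) (simp add: Suc_le_eq)
  then show ?thesis using rank_bounded[OF m] \<open>a \<in> S\<close> by (simp add: rank_Suc)
qed

lemma nth_elem_rank:
  assumes "a \<in> S" shows "nth_elem S (rank S a) = a"
proof -
  have "nth_elem S (rank S a) \<in> S" "rank S (nth_elem S (rank S a)) = rank S a"
    using nth_elem[of S "rank S a"] rank_less_card assms by blast+
  then show ?thesis using assms inj_onD[OF rank_inj_on] by blast
qed

text \<open>The leading entry demanded by \<^term>\<open>List\<close>: 0 for an infinite set, else the successor of its size.\<close>

definition count_code :: "nat set \<Rightarrow> nat" where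
  "count_code S = (if \<forall>m. \<exists>a. m < a \<and> a \<in> S then 0 else Suc (rank S (least0 (\<lambda>m. \<forall>a. a \<in> S \<longrightarrow> a < m))))"

lemma count_code_infinite: "infinite S \<Longrightarrow> count_code S = 0"
  by (simp add: count_code_def infinite_nat_iff_unbounded)

lemma count_code_finite:
  assumes "finite S" shows "count_code S = Suc (card S)"
proof -
  obtain m where "\<forall>a. a \<in> S \<longrightarrow> a < m" using assms finite_nat_set_iff_bounded by auto
  then have "\<forall>a. a \<in> S \<longrightarrow> a < least0 (\<lambda>m. \<forall>a. a \<in> S \<longrightarrow> a < m)" by (rule least0I)
  then have "rank S (least0 (\<lambda>m. \<forall>a. a \<in> S \<longrightarrow> a < m)) = card S" by (intro rank_bounded) blast
  moreover have "\<not> (\<forall>m. \<exists>a. m < a \<and> a \<in> S)" using assms infinite_nat_iff_unbounded by blast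
  ultimately show ?thesis by (simp add: count_code_def)
qed

text \<open>The conclusion has the shape of the disjunction in \<open>List\<close>, ready to be used
  with \<open>f\<close> the limit map and \<open>S\<close> a set of indices without
  repetition.\<close>

lemma enumerate_inj_image:
  assumes inj: "inj_on f S"
  defines "u \<equiv> \<lambda>i. f (nth_elem S i)" and "n \<equiv> count_code S"
  shows "n = 0 \<and> (\<forall>i j. i \<noteq> j \<longrightarrow> u i \<noteq> u j) \<and> f ` S = {u i |i. True} \<or>
    n > 0 \<and> finite (f ` S) \<and> card (f ` S) = n - 1 \<and> f ` S = {u i |i. i < n - 1}"
proof (cases "finite S")
  case True
  have n: "n = Suc (card S)" unfolding n_def using True by (rule count_code_finite)
  have "f ` S = {u i |i. i < card S}"
  proof (intro equalityI subsetI)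
    fix y assume "y \<in> f ` S"
    then obtain a where "a \<in> S" "y = f a" by blast
    then have "y = u (rank S a)" "rank S a < card S"
      by (simp_all add: u_def nth_elem_rank rank_less_card True)
    then show "y \<in> {u i |i. i < card S}" by blast
  next
    fix y assume "y \<in> {u i |i. i < card S}"
    then show "y \<in> f ` S" using nth_elem(1) unfolding u_def by blast
  qed
  moreover have "card (f ` S) = card S" using inj by (rule card_image)
  ultimately show ?thesis using True n by simp
next
  case False
  have "f ` S = {u i |i. True}"
  proof (intro equalityI subsetI)
    fix y assume "y \<in> f ` S"
    then obtain a where "a \<in> S" "y = f a" by blast
    then have "y = u (rank S a)" by (simp add: u_def nth_elem_rank)
    then show "y \<in> {u i |i. True}" by blast
  next
    fix y assume "y \<in> {u i |i. True}"
    then show "y \<in> f ` S" using nth_elem(1) False unfolding u_def by blast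
  qed
  moreover have "u i \<noteq> u j" if "i \<noteq> j" for i j
  proof
    assume "u i = u j"
    then have "nth_elem S i = nth_elem S j"
      unfolding u_def by (rule inj_onD[OF inj]) (simp_all add: nth_elem(1) False)
    then have "rank S (nth_elem S i) = rank S (nth_elem S j)" by simp
    then show False using that False by (simp add: nth_elem(2))
  qed
  ultimately show ?thesis using count_code_infinite[OF False] unfolding n_def by blast
qed

text \<open>Several indices may name the same value; keeping the least one of each gives injectivity
  at no loss.\<close>

lemma image_first_occurrences:
  fixes f :: "nat \<Rightarrow> 'a" and G :: "nat set"
  defines "S \<equiv> {a. a \<in> G \<and> (\<forall>b. b < a \<and> b \<in> G \<longrightarrow> f b \<noteq> f a)}"
  shows "f ` S = f ` G" "inj_on f S"
proof -
  have "f a \<in> f ` S" if "a \<in> G" for a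
  proof -
    define c where "c = (LEAST c. c \<in> G \<and> f c = f a)"
    have c: "c \<in> G \<and> f c = f a" unfolding c_def
      by (rule LeastI[of "\<lambda>c. c \<in> G \<and> f c = f a" a]) (simp add: that)
    have "f b \<noteq> f c" if "b < c" "b \<in> G" for b
      using not_less_Least[of b "\<lambda>c. c \<in> G \<and> f c = f a", folded c_def] that c by simp
    then have "c \<in> S" unfolding S_def using c by blast
    then show ?thesis using c by (metis imageI)
  qed
  then show "f ` S = f ` G" by (auto simp: S_def)
  show "inj_on f S"
    by (rule linorder_inj_onI) (auto simp: S_def)
qed

section \<open>Listing the paths\<close>

definition tree_of :: "baire \<Rightarrow> nat list set" where
  "tree_of p = {u. p (list_encode u) = 1}"

definition thin_names :: "baire set" where
  "thin_names = {p. is_tree (tree_of p) \<and> countable (paths (tree_of p))}"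

lemma ufun_oracle [ufun_intros]: "ufun D f \<Longrightarrow> ufun D (\<lambda>p n. p (f p n))"
  by (rule ufun_cfun_apply[of "\<lambda>p n. p n"]) (intro cfun_intros)

lemma ufun_left [ufun_intros]: "ufun D f \<Longrightarrow> ufun D (\<lambda>p n. left p (f p n))"
  by (rule ufun_cfun_apply[of "\<lambda>p n. left p n"]) (intro cfun_intros)

lemma ufun_right [ufun_intros]: "ufun D f \<Longrightarrow> ufun D (\<lambda>p n. right p (f p n))"
  by (rule ufun_cfun_apply[of "\<lambda>p n. right p n"]) (intro cfun_intros)

lemma ufun_least0 [ufun_intros]:
  assumes "upred D (\<lambda>p c. P p (efst c) (esnd c))" shows "ufun D (\<lambda>p n. least0 (\<lambda>k. P p n k))"
  unfolding least0_def by (rule ufun_Least) (rule assms)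

lemma prefix_list_decode_iff:
  "prefix (list_decode a) (list_decode b) \<longleftrightarrow> length (list_decode a) \<le> length (list_decode b) \<and>
    (\<forall>i<length (list_decode a). nth_code a i = nth_code b i)"
proof -
  have "prefix u v \<longleftrightarrow> length u \<le> length v \<and> (\<forall>i<length u. u ! i = v ! i)" for u v :: "nat list"
  proof (intro iffI conjI allI impI)
    assume "length u \<le> length v \<and> (\<forall>i<length u. u ! i = v ! i)"
    then have "u = take (length u) v" by (intro nth_equalityI) auto
    then show "prefix u v" by (metis take_is_prefix)
  qed (auto simp: prefix_nth prefix_length_le)
  then show ?thesis by (auto simp: nth_code)
qed

lemma upred_prefix [ufun_intros]:
  "ufun D f \<Longrightarrow> ufun D g \<Longrightarrow> upred D (\<lambda>p n. prefix (list_decode (f p n)) (list_decode (g p n)))"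
  by (rule upred_lift2[where F = "\<lambda>q n. prefix (list_decode (left q n)) (list_decode (right q n))"])
    (unfold prefix_list_decode_iff, intro cfun_intros, assumption+, simp)

definition stage_code :: "baire \<Rightarrow> baire" where
  "stage_code p n = (if stage_le (thin (tree_of p)) (list_decode (efst n)) (list_decode (esnd n)) then 1 else 0)"

lemma all_list_decode: "(\<forall>u. P u) \<longleftrightarrow> (\<forall>a. P (list_decode a))"
  by (metis list_encode_inverse)

text \<open>For codes of nodes, membership in \<open>thin\<close> costs just two number quantifiers,
  so the recursion for the stage comparison is arithmetical in the name and the candidate, and
  \<open>ufun_implicit\<close> applies.\<close>

lemma ufun_stage_code: "ufun thin_names stage_code"
proof (rule ufun_implicit)
  \<comment> \<open>\<open>left q\<close> is the name of the tree and \<open>right q\<close> the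
    candidate; its entries different from 1 stand for the negated comparison to which
    \<open>thin\<close> is applied.\<close>
  define below where "below q n \<longleftrightarrow> (\<forall>v w. left q v = 1 \<and> left q w = 1 \<and>
    prefix (list_decode (efst n)) (list_decode v) \<and> prefix (list_decode (efst n)) (list_decode w) \<and>
    \<not> prefix (list_decode v) (list_decode w) \<and> \<not> prefix (list_decode w) (list_decode v) \<longrightarrow>
    right q (enc (esnd n) v) \<noteq> 1 \<or> right q (enc (esnd n) w) \<noteq> 1)" for q n
  \<comment> \<open>Equality with a truth value also forces the entries to be 0 or 1, so that the
    candidate is unique as a sequence and not only as a relation.\<close>
  let ?C = "\<lambda>q n. right q n = (if below q n then 1 else 0)"
  show "upred UNIV ?C" unfolding below_def by (intro ufun_intros)
  fix p z :: baire assume p: "p \<in> thin_names"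
  define T where "T = tree_of p"
  define Y where "Y u v \<longleftrightarrow> z (enc (list_encode u) (list_encode v)) = 1" for u v
  have unique: "(\<forall>a b. Y a b \<longleftrightarrow> a \<in> thin T {c. \<not> Y b c}) \<longleftrightarrow> Y = stage_le (thin T)"
    using p by (intro stage_le_unique mono_thin lfp_thin) (auto simp: thin_names_def T_def)
  have below: "below (pair p z) n \<longleftrightarrow> list_decode (efst n) \<in> thin T {c. \<not> Y (list_decode (esnd n)) c}" for n
    unfolding below_def thin_def mem_Collect_eq T_def tree_of_def Y_def
    by (simp only: all_list_decode) simp
  have Y_decode: "Y (list_decode (efst n)) (list_decode (esnd n)) \<longleftrightarrow> z n = 1" for n
    by (simp add: Y_def)
  show "(\<forall>n. ?C (pair p z) n) \<longleftrightarrow> z = stage_code p"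
  proof
    assume "\<forall>n. ?C (pair p z) n"
    then have z: "z n = (if list_decode (efst n) \<in> thin T {c. \<not> Y (list_decode (esnd n)) c} then 1 else 0)" for n
      by (simp add: below)
    have "Y a b \<longleftrightarrow> a \<in> thin T {c. \<not> Y b c}" for a b
      unfolding Y_def[of a b] z by simp
    then have "Y = stage_le (thin T)" using unique by blast
    then have "stage_le (thin T) (list_decode (efst n)) (list_decode (esnd n)) \<longleftrightarrow> z n = 1" for n
      using Y_decode by simp
    moreover have "z n = 0 \<or> z n = 1" for n using z by simp
    ultimately show "z = stage_code p" unfolding stage_code_def T_def by (auto simp: fun_eq_iff)
  next
    assume z: "z = stage_code p"
    then have "Y = stage_le (thin T)" by (simp add: Y_def stage_code_def T_def fun_eq_iff)
    then have "\<forall>a b. Y a b \<longleftrightarrow> a \<in> thin T {c. \<not> Y b c}" using unique by blast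
    then have "below (pair p z) n \<longleftrightarrow> z n = 1" for n unfolding below Y_decode[symmetric] by blast
    moreover have "z n = 0 \<or> z n = 1" for n unfolding z stage_code_def by simp
    ultimately show "\<forall>n. ?C (pair p z) n" by auto
  qed
qed

text \<open>
  Two incompatible extensions of \<^term>\<open>a\<close> in the tree cannot both have the stage of \<^term>\<open>a\<close>,
  so the extensions of that stage lie on a single branch.
\<close>

definition branch :: "baire \<Rightarrow> nat \<Rightarrow> nat \<Rightarrow> bool" where
  "branch p a v \<longleftrightarrow> p v = 1 \<and> prefix (list_decode a) (list_decode v) \<and> stage_code p (enc a v) = 1"

definition infinite_branch :: "baire \<Rightarrow> nat \<Rightarrow> bool" where
  "infinite_branch p a \<longleftrightarrow> (\<forall>n. \<exists>v. branch p a v \<and> n < length (list_decode v))"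

text \<open>All nodes of the branch beyond length \<open>n\<close> agree at \<open>n\<close>; the
  least code is merely a definable choice among them.\<close>

definition limit :: "baire \<Rightarrow> nat \<Rightarrow> baire" where
  "limit p a n = nth_code (least0 (\<lambda>v. branch p a v \<and> n < length (list_decode v))) n"

text \<open>Different nodes can have the same limit, while \<open>List\<close> forbids repetitions.
  Equality of limits is spelled out as a number quantifier to keep the predicate
  arithmetical.\<close>

definition first_branch :: "baire \<Rightarrow> nat \<Rightarrow> bool" where
  "first_branch p a \<longleftrightarrow> infinite_branch p a \<and>
    (\<forall>b. b < a \<and> infinite_branch p b \<longrightarrow> \<not> (\<forall>n. limit p b n = limit p a n))"

text \<open>If there are only finitely many paths, the columns past their number hold arbitrary
  sequences, which \<open>List\<close> permits.\<close>

definition listing :: "baire \<Rightarrow> baire" where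
  "listing p = count_code {a. first_branch p a} \<frown> tuple (\<lambda>i. limit p (nth_elem {a. first_branch p a} i))"

lemma paths_eq_limits:
  assumes p: "p \<in> thin_names"
  shows "paths (tree_of p) = limit p ` {a. infinite_branch p a}"
proof -
  let ?T = "tree_of p" and ?Y = "stage_le (thin (tree_of p))"
  have tree: "is_tree ?T" and lfp: "lfp (thin ?T) = UNIV"
    using p lfp_thin by (auto simp: thin_names_def)
  have unique: "?Y a b \<longleftrightarrow> a \<in> thin ?T {c. \<not> ?Y b c}" for a b
    using stage_le_unique[OF mono_thin lfp, of ?Y] by blast
  have min: "\<exists>a\<in>Z. \<forall>b\<in>Z. ?Y a b" if "z \<in> Z" for z Z
    by (rule stage_le_minimal[OF mono_thin lfp that])
  have branch: "branch p a v \<longleftrightarrow> list_decode v \<in> ?T \<and> prefix (list_decode a) (list_decode v) \<and>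
      ?Y (list_decode a) (list_decode v)" for a v
    by (simp add: branch_def tree_of_def stage_code_def)
  have compatible: "prefix (list_decode v) (list_decode w) \<or> prefix (list_decode w) (list_decode v)"
    if "branch p a v" "branch p a w" for a v w
  proof -
    \<comment> \<open>Reflexivity, inserted into the recursion, says that of two incompatible
      extensions of \<open>a\<close> in the tree one enters strictly before \<open>a\<close>, hence
      is not on the branch.\<close>
    have "?Y (list_decode a) (list_decode a)" using min[of "list_decode a" "{list_decode a}"] by blast
    then have "list_decode a \<in> thin ?T {c. \<not> ?Y (list_decode a) c}" using unique by blast
    then show ?thesis using that unfolding branch thin_def[of ?T "{c. _ c}"] by blast
  qed
  have limit: "limit p a n = list_decode v ! n" if v: "branch p a v" "n < length (list_decode v)" for a v n
  proof -
    define w where "w = least0 (\<lambda>v. branch p a v \<and> n < length (list_decode v))"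
    have w: "branch p a w \<and> n < length (list_decode w)"
      unfolding w_def by (rule least0I[of "\<lambda>v. branch p a v \<and> n < length (list_decode v)", OF conjI[OF v]])
    then have "limit p a n = list_decode w ! n" unfolding limit_def w_def[symmetric] by (simp add: nth_code)
    then show ?thesis using compatible[of a v w] prefix_nth v w by metis
  qed
  show ?thesis
  proof (intro equalityI subsetI)
    fix x assume x: "x \<in> paths ?T"
    let ?Z = "range (\<lambda>n. map x [0..<n])"
    \<comment> \<open>A prefix of least stage among all prefixes of \<open>x\<close>: every longer
      prefix then belongs to its branch.\<close>
    obtain m where m: "\<And>n. ?Y (map x [0..<m]) (map x [0..<n])"
      using min[of "map x [0..<0]" ?Z] by blast
    define a where "a = list_encode (map x [0..<m])"
    have br: "branch p a (list_encode (map x [0..<n]))" if "m \<le> n" for n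
      using x m that by (simp add: branch a_def paths_def prefix_map_upt)
    have "infinite_branch p a"
      unfolding infinite_branch_def
    proof (intro allI exI conjI)
      fix n
      show "branch p a (list_encode (map x [0..<max m (Suc n)]))" by (rule br) simp
      show "n < length (list_decode (list_encode (map x [0..<max m (Suc n)])))" by simp
    qed
    moreover have "limit p a n = x n" for n
      using limit[OF br[of "max m (Suc n)"], of n] by (simp del: upt_Suc)
    then have "x = limit p a" by auto
    ultimately show "x \<in> limit p ` {a. infinite_branch p a}" by blast
  next
    fix x assume "x \<in> limit p ` {a. infinite_branch p a}"
    then obtain a where a: "infinite_branch p a" "x = limit p a" by blast
    show "x \<in> paths ?T"
      unfolding paths_def
    proof (intro CollectI allI)
      fix n
      obtain v where v: "branch p a v" "n < length (list_decode v)"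
        using a(1) unfolding infinite_branch_def by blast
      have "map x [0..<n] = take n (list_decode v)"
        using v limit[OF v(1)] a(2) by (intro nth_equalityI) auto
      moreover have "take n (list_decode v) @ drop n (list_decode v) \<in> ?T" using v(1) by (simp add: branch)
      ultimately show "map x [0..<n] \<in> ?T" using tree unfolding is_tree_def by metis
    qed
  qed
qed

lemma listing_in_List:
  assumes p: "closed_rep p = Some A" "countable A"
  shows "p \<in> thin_names" "listing p \<in> vals List A"
proof -
  have A: "is_tree (tree_of p)" "A = paths (tree_of p)"
    using p(1) by (auto simp: closed_rep_def tree_of_def Let_def split: if_splits)
  then show thin: "p \<in> thin_names" using p(2) by (simp add: thin_names_def)
  let ?G = "{a. infinite_branch p a}" and ?S = "{a. first_branch p a}"
  have S: "?S = {a. a \<in> ?G \<and> (\<forall>b. b < a \<and> b \<in> ?G \<longrightarrow> limit p b \<noteq> limit p a)}"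
    unfolding first_branch_def mem_Collect_eq fun_eq_iff ..
  have "limit p ` ?S = A" "inj_on (limit p) ?S"
    unfolding S using image_first_occurrences[of "limit p" ?G] paths_eq_limits[OF thin] A(2) by simp_all
  note enum = enumerate_inj_image[OF this(2), unfolded this(1)]
  have "closed A" using A(2) closed_paths by simp
  then show "listing p \<in> vals List A"
    unfolding List_def problem.simps mem_Collect_eq listing_def
    using p(2) enum by blast
qed

text \<open>Everything in \<open>listing\<close> is arithmetical in \<open>stage_code\<close>. After
  each notion the \<open>_apply\<close> rule is stated, so that it can be used below at computed
  arguments.\<close>

lemma ufun_listing: "ufun thin_names listing"
proof -
  have "upred thin_names (\<lambda>p c. branch p (efst c) (esnd c))"
    unfolding branch_def by (intro ufun_intros ufun_apply[OF ufun_stage_code])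
  note br0 = upred_apply[OF this]
  have br: "ufun thin_names f \<Longrightarrow> ufun thin_names g \<Longrightarrow> upred thin_names (\<lambda>p n. branch p (f p n) (g p n))" for f g
    using br0[of "\<lambda>p n. enc (f p n) (g p n)"] ufun_enc[of thin_names f g] by simp
  have "upred thin_names infinite_branch"
    unfolding infinite_branch_def by (intro ufun_intros br)
  note inf = upred_apply[OF this]
  have "ufun thin_names (\<lambda>p c. limit p (efst c) (esnd c))"
    unfolding limit_def by (intro ufun_intros br)
  note lim0 = ufun_apply[OF this]
  have lim: "ufun thin_names f \<Longrightarrow> ufun thin_names g \<Longrightarrow> ufun thin_names (\<lambda>p n. limit p (f p n) (g p n))" for f g
    using lim0[of "\<lambda>p n. enc (f p n) (g p n)"] ufun_enc[of thin_names f g] by simp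
  have "upred thin_names first_branch"
    unfolding first_branch_def by (intro ufun_intros inf lim)
  note first = upred_apply[OF this]
  have count: "ufun thin_names (\<lambda>p n. count_code {a. first_branch p a})"
    unfolding count_code_def rank_def mem_Collect_eq by (intro ufun_intros first)
  have "ufun thin_names (\<lambda>p n. nth_elem {a. first_branch p a} n)"
    unfolding nth_elem_def rank_def mem_Collect_eq by (intro ufun_intros first)
  note elem = ufun_apply[OF this]
  have "ufun thin_names (\<lambda>p n. case_nat (count_code {a. first_branch p a})
      (\<lambda>m. limit p (nth_elem {a. first_branch p a} (efst m)) (esnd m)) n)"
    by (intro ufun_case_nat count lim elem ufun_intros)
  then show ?thesis
    by (rule ufun_cong) (auto simp: listing_def fun_eq_iff tuple_def efst_def esnd_def split: nat.split prod.split)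
qed

lemma List_le_UC: "List \<le>\<^sub>W UC_Baire"
proof (rule ufun_le_UC[OF ufun_listing])
  fix A p assume "A \<in> dom_problem List" "source List p = Some A"
  then have p: "closed_rep p = Some A" "countable A"
    unfolding dom_List by (simp_all add: List_def)
  show "p \<in> thin_names \<and> (\<exists>y. target List (listing p) = Some y \<and> y \<in> vals List A)"
    using listing_in_List[OF p] by (simp add: List_def baire_rep_def)
qed

theorem theorem6p4:
  shows "wList \<equiv>\<^sub>W List \<and> List \<equiv>\<^sub>W UC_Baire"
  unfolding weihrauch_equiv_def
  by (meson UC_le_wList wList_le_List List_le_UC weihrauch_le_trans)

end
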